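(* Let $\mathcal P$ be a uniform approximate projection on a complex Banach space $\mathbf Y$, let $A\in\mathcal L(\mathbf Y,\mathcal P)$ be $\mathcal P$-Fredholm, and suppose that the coset $A+\mathcal K(\mathbf Y,\mathcal P)$ contains a Fredholm operator. Then $$\nu_{\rm ess}(A\oplus A^* )=\tilde\mu(A\oplus A^* )=\mu(A)=\|(A+\mathcal K(\mathbf Y,\mathcal P))^{-1}\|^{-1}.$$
   Context: A uniform approximate projection on $\mathbf Y$ is a sequence $\mathcal P=(P_n)_{n\in\mathbb N}$ of projections such that, with $Q_n:=I-P_n$: ($\mathcal P1$) $P_n=P_nP_{n+1}=P_{n+1}P_n$ and $\|P_n\|=\|Q_n\|=1$ for all $n$; ($\mathcal P2$) $\sup_U\|\sum_{n\in U}(P_{n+1}-P_n)\|<\infty$, the supremum over all finite $U\subset\mathbb N$. Then $\mathcal P^*=(P_n^* )$ is a uniform approximate projection on the dual space $\mathbf Y^*$. $\mathcal K(\mathbf Y,\mathcal P):=\{K\in\mathcal L(\mathbf Y):\|Q_nK\|+\|KQ_n\|\to0\}$; $\mathcal L(\mathbf Y,\mathcal P):=\{A\in\mathcal L(\mathbf Y):AK,KA\in\mathcal K(\mathbf Y,\mathcal P)\ \forall K\in\mathcal K(\mathbf Y,\mathcal P)\}$, a closed subalgebra of $\mathcal L(\mathbf Y)$ containing $\mathcal K(\mathbf Y,\mathcal P)$ as a closed two-sided ideal. $A\in\mathcal L(\mathbf Y,\mathcal P)$ is $\mathcal P$-Fredholm if $A+\mathcal K(\mathbf Y,\mathcal P)$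 is invertible in $\mathcal L(\mathbf Y,\mathcal P)/\mathcal K(\mathbf Y,\mathcal P)$; the norm of the inverse coset is the quotient norm. The same definitions apply to any other Banach space with a uniform approximate projection. $\mathbf Y\oplus\mathbf Y^*$ is the space of pairs $(x,f)\in\mathbf Y\times\mathbf Y^*$ with norm $\max\{\|x\|,\|f\|\}$, equipped with the uniform approximate projection $\mathcal P\oplus\mathcal P^*=(P_n\oplus P_n^* )$, and $(A\oplus A^* )(x,f):=(Ax,A^*f)$. Lower norm: $\nu(B):=\inf\{\|Bx\|:\|x\|=1\}$. $\tilde\mu(A):=\lim_{m\to\infty}\nu(A|_{\mathrm{im}\,Q_m})$ (limit exists by monotonicity), $\tilde\mu(A^* ):=\lim_m\nu(A^*|_{\mathrm{im}\,Q_m^*})$, $\mu(A):=\min\{\tilde\mu(A),\tilde\mu(A^* )\}$, and $\tilde\mu(A\oplus A^* ):=\lim_m\nu((A\oplus A^* )|_{\mathrm{im}(Q_m\oplus Q_m^* )})$. $\nu_{\rm ess}(A\oplus A^* ):=\sup\{\nu(A\oplus A^*+K):K\in\mathcal K(\mathbf Y\oplus\mathbf Y^*,\mathcal P\oplus\mathcal P^* )\}$. Fredholm means finite-dimensional kernel and finite-codimensional range. *)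

theory Defs
  imports "HOL-Analysis.Analysis" "HOL-Algebra.QuotRing"
begin

section \<open>Complex Banach spaces\<close>

class complex_normed_vector = real_normed_vector +
  fixes scaleC :: "complex \<Rightarrow> 'a \<Rightarrow> 'a"  (infixr \<open>*\<^sub>C\<close> 75)
  assumes scaleR_scaleC: "r *\<^sub>R x = complex_of_real r *\<^sub>C x"
    and scaleC_add_right: "a *\<^sub>C (x + y) = a *\<^sub>C x + a *\<^sub>C y"
    and scaleC_add_left: "(a + b) *\<^sub>C x = a *\<^sub>C x + b *\<^sub>C x"
    and scaleC_scaleC: "a *\<^sub>C b *\<^sub>C x = (a * b) *\<^sub>C x"
    and norm_scaleC: "norm (a *\<^sub>C x) = cmod a * norm x"

class complex_banach = complex_normed_vector + complete_space

subclass (in complex_banach) banach ..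

lemma scaleC_one: "1 *\<^sub>C x = (x :: 'a::complex_normed_vector)"
  by (metis of_real_1 scaleR_one scaleR_scaleC)

global_interpretation complex_vector:
  vector_space "scaleC :: complex \<Rightarrow> 'a \<Rightarrow> 'a::complex_normed_vector"
  by unfold_locales (simp_all add: scaleC_add_right scaleC_add_left scaleC_scaleC scaleC_one)

instantiation complex :: complex_banach
begin
definition scaleC_complex :: "complex \<Rightarrow> complex \<Rightarrow> complex"
  where "scaleC_complex = (*)"
instance
  by standard (auto simp: scaleC_complex_def scaleR_conv_of_real algebra_simps norm_mult)
end

lemma bounded_linear_scaleC: "bounded_linear (\<lambda>x. c *\<^sub>C (x :: 'a::complex_normed_vector))"
proof (rule bounded_linear_intro[where K = "cmod c"])
  show "c *\<^sub>C (x + y) = c *\<^sub>C x + c *\<^sub>C y" for x y :: 'a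
    by (rule scaleC_add_right)
  show "c *\<^sub>C r *\<^sub>R x = r *\<^sub>R c *\<^sub>C x" for r and x :: 'a
    by (simp add: scaleR_scaleC scaleC_scaleC mult.commute)
  show "norm (c *\<^sub>C x) \<le> norm x * cmod c" for x :: 'a
    by (simp add: norm_scaleC mult.commute)
qed


section \<open>Bounded complex-linear operators\<close>

typedef (overloaded) ('a, 'b) cblinfun  (\<open>(_ \<Rightarrow>\<^bsub>CL\<^esub> /_)\<close> [22, 21] 21) =
  "{f :: 'a::complex_normed_vector \<Rightarrow> 'b::complex_normed_vector.
      bounded_linear f \<and> (\<forall>c x. f (c *\<^sub>C x) = c *\<^sub>C f x)}"
  morphisms cblinfun_apply CBlinfun
  by (rule exI[where x = "\<lambda>_. 0"]) auto

setup_lifting type_definition_cblinfun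

declare [[coercion
  "cblinfun_apply :: ('a::complex_normed_vector \<Rightarrow>\<^bsub>CL\<^esub> 'b::complex_normed_vector) \<Rightarrow> 'a \<Rightarrow> 'b"]]

lemma cblinfun_eqI: "(\<And>x. cblinfun_apply f x = cblinfun_apply g x) \<Longrightarrow> f = g"
  by transfer auto

lemma bounded_linear_cblinfun: "bounded_linear (cblinfun_apply f)"
  by transfer auto

lemma cblinfun_scaleC: "cblinfun_apply f (c *\<^sub>C x) = c *\<^sub>C f x"
  by transfer auto

instantiation cblinfun :: (complex_normed_vector, complex_normed_vector) complex_normed_vector
begin

lift_definition norm_cblinfun :: "'a \<Rightarrow>\<^bsub>CL\<^esub> 'b \<Rightarrow> real" is onorm .

lift_definition zero_cblinfun :: "'a \<Rightarrow>\<^bsub>CL\<^esub> 'b" is "\<lambda>x. 0"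
  by simp

lift_definition plus_cblinfun :: "'a \<Rightarrow>\<^bsub>CL\<^esub> 'b \<Rightarrow> 'a \<Rightarrow>\<^bsub>CL\<^esub> 'b \<Rightarrow> 'a \<Rightarrow>\<^bsub>CL\<^esub> 'b" is "\<lambda>f g x. f x + g x"
  by (auto simp: bounded_linear_add scaleC_add_right)

lift_definition minus_cblinfun :: "'a \<Rightarrow>\<^bsub>CL\<^esub> 'b \<Rightarrow> 'a \<Rightarrow>\<^bsub>CL\<^esub> 'b \<Rightarrow> 'a \<Rightarrow>\<^bsub>CL\<^esub> 'b" is "\<lambda>f g x. f x - g x"
  by (auto simp: bounded_linear_sub complex_vector.scale_right_diff_distrib)

lift_definition uminus_cblinfun :: "'a \<Rightarrow>\<^bsub>CL\<^esub> 'b \<Rightarrow> 'a \<Rightarrow>\<^bsub>CL\<^esub> 'b" is "\<lambda>f x. - f x"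
  by (auto simp: bounded_linear_minus)

lift_definition scaleR_cblinfun :: "real \<Rightarrow> 'a \<Rightarrow>\<^bsub>CL\<^esub> 'b \<Rightarrow> 'a \<Rightarrow>\<^bsub>CL\<^esub> 'b" is "\<lambda>r f x. r *\<^sub>R f x"
  by (auto intro: bounded_linear_compose[OF bounded_linear_scaleC]
      simp: scaleR_scaleC scaleC_scaleC mult.commute)

lift_definition scaleC_cblinfun :: "complex \<Rightarrow> 'a \<Rightarrow>\<^bsub>CL\<^esub> 'b \<Rightarrow> 'a \<Rightarrow>\<^bsub>CL\<^esub> 'b" is "\<lambda>c f x. c *\<^sub>C f x"
  by (auto intro: bounded_linear_compose[OF bounded_linear_scaleC]
      simp: scaleC_scaleC mult.commute)

definition dist_cblinfun :: "'a \<Rightarrow>\<^bsub>CL\<^esub> 'b \<Rightarrow> 'a \<Rightarrow>\<^bsub>CL\<^esub> 'b \<Rightarrow> real"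
  where "dist_cblinfun f g = norm (f - g)"

definition sgn_cblinfun :: "'a \<Rightarrow>\<^bsub>CL\<^esub> 'b \<Rightarrow> 'a \<Rightarrow>\<^bsub>CL\<^esub> 'b"
  where "sgn_cblinfun f = inverse (norm f) *\<^sub>R f"

definition uniformity_cblinfun :: "(('a \<Rightarrow>\<^bsub>CL\<^esub> 'b) \<times> ('a \<Rightarrow>\<^bsub>CL\<^esub> 'b)) filter"
  where "uniformity_cblinfun = (INF e\<in>{0<..}. principal {(f, g). dist f g < e})"

definition open_cblinfun :: "('a \<Rightarrow>\<^bsub>CL\<^esub> 'b) set \<Rightarrow> bool"
  where "open_cblinfun S = (\<forall>f\<in>S. \<forall>\<^sub>F (f', g) in uniformity. f' = f \<longrightarrow> g \<in> S)"

lemma onorm_scaleC_aux: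
  fixes f :: "'a \<Rightarrow> 'b"
  assumes "bounded_linear f"
  shows "onorm (\<lambda>x. c *\<^sub>C f x) = cmod c * onorm f"
proof (rule antisym)
  note cf = bounded_linear_compose[OF bounded_linear_scaleC assms, of c]
  show "onorm (\<lambda>x. c *\<^sub>C f x) \<le> cmod c * onorm f"
  proof (rule onorm_bound)
    show "0 \<le> cmod c * onorm f"
      using onorm_pos_le[OF assms] by simp
    show "norm (c *\<^sub>C f x) \<le> cmod c * onorm f * norm x" for x
      using mult_left_mono[OF onorm[OF assms, of x], of "cmod c"] by (simp add: norm_scaleC mult.assoc)
  qed
  show "cmod c * onorm f \<le> onorm (\<lambda>x. c *\<^sub>C f x)"
  proof (cases "c = 0")
    case True
    then show ?thesis using onorm_pos_le[OF cf] by simp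
  next
    case False
    have "onorm f \<le> onorm (\<lambda>x. c *\<^sub>C f x) / cmod c"
    proof (rule onorm_bound)
      show "0 \<le> onorm (\<lambda>x. c *\<^sub>C f x) / cmod c"
        using onorm_pos_le[OF cf] by simp
      show "norm (f x) \<le> onorm (\<lambda>x. c *\<^sub>C f x) / cmod c * norm x" for x
        using onorm[OF cf, of x] False by (simp add: norm_scaleC field_simps)
    qed
    then show ?thesis using False by (simp add: field_simps)
  qed
qed

instance
proof
  fix f g h :: "'a \<Rightarrow>\<^bsub>CL\<^esub> 'b" and a b :: complex and r s :: real
  show "f + g + h = f + (g + h)" by transfer (simp add: algebra_simps)
  show "f + g = g + f" by transfer (simp add: algebra_simps)
  show "0 + f = f" by transfer simp
  show "- f + f = 0" by transfer simp
  show "f - g = f + - g" by transfer simp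
  show "r *\<^sub>R (f + g) = r *\<^sub>R f + r *\<^sub>R g" by transfer (simp add: algebra_simps)
  show "(r + s) *\<^sub>R f = r *\<^sub>R f + s *\<^sub>R f" by transfer (simp add: algebra_simps)
  show "r *\<^sub>R s *\<^sub>R f = (r * s) *\<^sub>R f" by transfer simp
  show "1 *\<^sub>R f = f" by transfer simp
  show "sgn f = inverse (norm f) *\<^sub>R f" by (rule sgn_cblinfun_def)
  show "dist f g = norm (f - g)" by (rule dist_cblinfun_def)
  show "(uniformity :: (('a \<Rightarrow>\<^bsub>CL\<^esub> 'b) \<times> ('a \<Rightarrow>\<^bsub>CL\<^esub> 'b)) filter)
      = (INF e\<in>{0<..}. principal {(f, g). dist f g < e})"
    by (rule uniformity_cblinfun_def)
  show "open S = (\<forall>f\<in>S. \<forall>\<^sub>F (f', g) in uniformity. f' = f \<longrightarrow> g \<in> S)" for S :: "('a \<Rightarrow>\<^bsub>CL\<^esub> 'b) set"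
    by (rule open_cblinfun_def)
  show "norm f = 0 \<longleftrightarrow> f = 0" by transfer (auto simp: onorm_eq_0)
  show "norm (f + g) \<le> norm f + norm g" by transfer (auto intro: onorm_triangle)
  show "norm (r *\<^sub>R f) = \<bar>r\<bar> * norm f" by transfer (auto intro: onorm_scaleR)
  show "r *\<^sub>R f = complex_of_real r *\<^sub>C f" by transfer (simp add: scaleR_scaleC)
  show "a *\<^sub>C (f + g) = a *\<^sub>C f + a *\<^sub>C g" by transfer (simp add: scaleC_add_right)
  show "(a + b) *\<^sub>C f = a *\<^sub>C f + b *\<^sub>C f" by transfer (simp add: scaleC_add_left)
  show "a *\<^sub>C b *\<^sub>C f = (a * b) *\<^sub>C f" by transfer (simp add: scaleC_scaleC)
  show "norm (a *\<^sub>C f) = cmod a * norm f" by transfer (auto intro: onorm_scaleC_aux)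
qed

end

lemma norm_cblinfun: "norm (cblinfun_apply f x) \<le> norm f * norm x"
  by transfer (auto intro: onorm)

lemma norm_cblinfun_bound:
  "0 \<le> b \<Longrightarrow> (\<And>x. norm (cblinfun_apply f x) \<le> b * norm x) \<Longrightarrow> norm f \<le> b"
  by transfer (auto intro: onorm_bound)

instance cblinfun :: (complex_normed_vector, complex_banach) complex_banach
proof
  fix X :: "nat \<Rightarrow> 'a \<Rightarrow>\<^bsub>CL\<^esub> 'b"
  assume "Cauchy X"
  define R :: "('a \<Rightarrow>\<^bsub>CL\<^esub> 'b) \<Rightarrow> ('a \<Rightarrow>\<^sub>L 'b)" where "R f = Blinfun (cblinfun_apply f)" for f
  have R: "blinfun_apply (R f) = cblinfun_apply f" for f
    by (simp add: R_def bounded_linear_Blinfun_apply bounded_linear_cblinfun)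
  have norm_R: "norm (R f - R g) = norm (f - g)" for f g
  proof -
    have "blinfun_apply (R f - R g) = cblinfun_apply (f - g)"
      by (auto simp: minus_blinfun.rep_eq minus_cblinfun.rep_eq R)
    then show ?thesis by (simp add: norm_blinfun.rep_eq norm_cblinfun.rep_eq)
  qed
  have "Cauchy (\<lambda>n. R (X n))"
    using \<open>Cauchy X\<close> by (simp add: Cauchy_def dist_norm norm_R)
  then obtain L where L: "(\<lambda>n. R (X n)) \<longlonglongrightarrow> L"
    using Cauchy_convergent_iff convergent_def by blast
  have Lx: "(\<lambda>n. X n x) \<longlonglongrightarrow> L x" for x
    using bounded_linear.tendsto[OF blinfun.bounded_linear_left L, of x] by (simp add: R)
  have "L (c *\<^sub>C x) = c *\<^sub>C L x" for c x
    using LIMSEQ_unique[OF Lx[of "c *\<^sub>C x"]]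
      bounded_linear.tendsto[OF bounded_linear_scaleC Lx, of c x]
    by (simp add: cblinfun_scaleC)
  then have "cblinfun_apply (CBlinfun (blinfun_apply L)) = blinfun_apply L"
    by (intro CBlinfun_inverse) (auto simp: blinfun.bounded_linear_right)
  then have "R (CBlinfun (blinfun_apply L)) = L"
    by (simp add: R_def blinfun_apply_inverse)
  then have "X \<longlonglongrightarrow> CBlinfun (blinfun_apply L)"
    using L by (metis (no_types, lifting) LIMSEQ_iff norm_R)
  then show "convergent X" by (auto simp: convergent_def)
qed

lift_definition cblinfun_id :: "'a::complex_normed_vector \<Rightarrow>\<^bsub>CL\<^esub> 'a" is "\<lambda>x. x"
  by simp

lift_definition cblinfun_compose ::
  "('b::complex_normed_vector \<Rightarrow>\<^bsub>CL\<^esub> 'c::complex_normed_vector) \<Rightarrow>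
    ('a::complex_normed_vector \<Rightarrow>\<^bsub>CL\<^esub> 'b) \<Rightarrow> 'a \<Rightarrow>\<^bsub>CL\<^esub> 'c"  (infixl \<open>o\<^sub>C\<close> 67)
  is "\<lambda>f g x. f (g x)"
  by (auto intro: bounded_linear_compose)

lemma norm_cblinfun_compose: "norm (f o\<^sub>C g) \<le> norm f * norm g"
proof (rule norm_cblinfun_bound)
  show "norm (cblinfun_apply (f o\<^sub>C g) x) \<le> norm f * norm g * norm x" for x
    using order_trans[OF norm_cblinfun mult_left_mono[OF norm_cblinfun[of g x], of "norm f"]]
    by (simp add: cblinfun_compose.rep_eq mult.assoc)
qed simp

lemma cblinfun_compose_assoc: "(f o\<^sub>C g) o\<^sub>C h = f o\<^sub>C (g o\<^sub>C h)"
  by transfer simp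

lemma cblinfun_compose_id: "f o\<^sub>C cblinfun_id = f" "cblinfun_id o\<^sub>C f = f"
  by (transfer, simp)+

lemma cblinfun_compose_add_left: "(f + g) o\<^sub>C h = f o\<^sub>C h + g o\<^sub>C h"
  by transfer simp

lemma cblinfun_compose_add_right: "f o\<^sub>C (g + h) = f o\<^sub>C g + f o\<^sub>C h"
  by transfer (auto simp: linear_simps)

lemma cblinfun_compose_minus: "(- f) o\<^sub>C h = - (f o\<^sub>C h)" "f o\<^sub>C (- h) = - (f o\<^sub>C h)"
  by (transfer, auto simp: linear_simps)+

lemma cblinfun_compose_scaleC_left: "(c *\<^sub>C f) o\<^sub>C h = c *\<^sub>C (f o\<^sub>C h)"
  by transfer simp

lemma cblinfun_compose_zero: "0 o\<^sub>C h = 0" "f o\<^sub>C 0 = 0"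
  by (transfer, auto simp: linear_simps)+

text \<open>The Banach space adjoint acts on complex-linear functionals by \<open>f \<mapsto> f \<circ> A\<close>.\<close>

type_synonym 'a cdual = "'a \<Rightarrow>\<^bsub>CL\<^esub> complex"

lift_definition cblinfun_adjoint ::
  "('a::complex_normed_vector \<Rightarrow>\<^bsub>CL\<^esub> 'b::complex_normed_vector) \<Rightarrow> 'b cdual \<Rightarrow>\<^bsub>CL\<^esub> 'a cdual"
  is "\<lambda>A f. f o\<^sub>C A"
proof (intro conjI allI)
  fix A :: "'a \<Rightarrow>\<^bsub>CL\<^esub> 'b"
  show "bounded_linear (\<lambda>f :: 'b cdual. f o\<^sub>C A)"
    by (rule bounded_linear_intro[where K = "norm A"])
      (auto simp: cblinfun_compose_add_left scaleR_scaleC cblinfun_compose_scaleC_left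
        norm_cblinfun_compose)
  show "c *\<^sub>C f o\<^sub>C A = c *\<^sub>C (f o\<^sub>C A)" for c and f :: "'b cdual"
    by (rule cblinfun_compose_scaleC_left)
qed


section \<open>Direct sums with the maximum norm\<close>

text \<open>The library norm on \<^typ>\<open>'a \<times> 'b\<close> is the Euclidean one, hence a separate type.\<close>

typedef ('a, 'b) max_sum = "UNIV :: ('a \<times> 'b) set"
  morphisms max_sum_prod Max_Sum by simp

setup_lifting type_definition_max_sum

lemma max_sum_expand:
  "x = y \<longleftrightarrow> fst (max_sum_prod x) = fst (max_sum_prod y) \<and> snd (max_sum_prod x) = snd (max_sum_prod y)"
  by (metis max_sum_prod_inject prod_eq_iff)

instantiation max_sum :: (complex_normed_vector, complex_normed_vector) complex_normed_vector
begin

lift_definition norm_max_sum :: "('a, 'b) max_sum \<Rightarrow> real"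
  is "\<lambda>(x, y). max (norm x) (norm y)" .

lift_definition zero_max_sum :: "('a, 'b) max_sum" is "(0, 0)" .

lift_definition plus_max_sum :: "('a, 'b) max_sum \<Rightarrow> ('a, 'b) max_sum \<Rightarrow> ('a, 'b) max_sum"
  is "\<lambda>(x, y) (x', y'). (x + x', y + y')" .

lift_definition minus_max_sum :: "('a, 'b) max_sum \<Rightarrow> ('a, 'b) max_sum \<Rightarrow> ('a, 'b) max_sum"
  is "\<lambda>(x, y) (x', y'). (x - x', y - y')" .

lift_definition uminus_max_sum :: "('a, 'b) max_sum \<Rightarrow> ('a, 'b) max_sum"
  is "\<lambda>(x, y). (- x, - y)" .

lift_definition scaleR_max_sum :: "real \<Rightarrow> ('a, 'b) max_sum \<Rightarrow> ('a, 'b) max_sum"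
  is "\<lambda>r (x, y). (r *\<^sub>R x, r *\<^sub>R y)" .

lift_definition scaleC_max_sum :: "complex \<Rightarrow> ('a, 'b) max_sum \<Rightarrow> ('a, 'b) max_sum"
  is "\<lambda>c (x, y). (c *\<^sub>C x, c *\<^sub>C y)" .

definition dist_max_sum :: "('a, 'b) max_sum \<Rightarrow> ('a, 'b) max_sum \<Rightarrow> real"
  where "dist_max_sum p q = norm (p - q)"

definition sgn_max_sum :: "('a, 'b) max_sum \<Rightarrow> ('a, 'b) max_sum"
  where "sgn_max_sum p = inverse (norm p) *\<^sub>R p"

definition uniformity_max_sum :: "(('a, 'b) max_sum \<times> ('a, 'b) max_sum) filter"
  where "uniformity_max_sum = (INF e\<in>{0<..}. principal {(p, q). dist p q < e})"

definition open_max_sum :: "('a, 'b) max_sum set \<Rightarrow> bool"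
  where "open_max_sum S = (\<forall>p\<in>S. \<forall>\<^sub>F (p', q) in uniformity. p' = p \<longrightarrow> q \<in> S)"

instance
proof
  fix p q s :: "('a, 'b) max_sum" and a b :: complex and r t :: real
  show "p + q + s = p + (q + s)" by transfer (auto simp: algebra_simps)
  show "p + q = q + p" by transfer (auto simp: algebra_simps)
  show "0 + p = p" by transfer auto
  show "- p + p = 0" by transfer auto
  show "p - q = p + - q" by transfer auto
  show "r *\<^sub>R (p + q) = r *\<^sub>R p + r *\<^sub>R q" by transfer (auto simp: algebra_simps)
  show "(r + t) *\<^sub>R p = r *\<^sub>R p + t *\<^sub>R p" by transfer (auto simp: algebra_simps)
  show "r *\<^sub>R t *\<^sub>R p = (r * t) *\<^sub>R p" by transfer auto
  show "1 *\<^sub>R p = p" by transfer auto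
  show "sgn p = inverse (norm p) *\<^sub>R p" by (rule sgn_max_sum_def)
  show "dist p q = norm (p - q)" by (rule dist_max_sum_def)
  show "(uniformity :: (('a, 'b) max_sum \<times> ('a, 'b) max_sum) filter)
      = (INF e\<in>{0<..}. principal {(p, q). dist p q < e})"
    by (rule uniformity_max_sum_def)
  show "open S = (\<forall>p\<in>S. \<forall>\<^sub>F (p', q) in uniformity. p' = p \<longrightarrow> q \<in> S)" for S :: "('a, 'b) max_sum set"
    by (rule open_max_sum_def)
  show "norm p = 0 \<longleftrightarrow> p = 0"
    by transfer (auto simp: max_def split: if_splits)
  show "norm (p + q) \<le> norm p + norm q"
    by transfer (auto intro!: order_trans[OF norm_triangle_ineq] add_mono)
  show "norm (r *\<^sub>R p) = \<bar>r\<bar> * norm p"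
    by transfer (auto simp: max_mult_distrib_left)
  show "r *\<^sub>R p = complex_of_real r *\<^sub>C p" by transfer (auto simp: scaleR_scaleC)
  show "a *\<^sub>C (p + q) = a *\<^sub>C p + a *\<^sub>C q" by transfer (auto simp: scaleC_add_right)
  show "(a + b) *\<^sub>C p = a *\<^sub>C p + b *\<^sub>C p" by transfer (auto simp: scaleC_add_left)
  show "a *\<^sub>C b *\<^sub>C p = (a * b) *\<^sub>C p" by transfer (auto simp: scaleC_scaleC)
  show "norm (a *\<^sub>C p) = cmod a * norm p"
    by transfer (auto simp: norm_scaleC max_mult_distrib_left)
qed

end

instance max_sum :: (complex_banach, complex_banach) complex_banach
proof
  fix X :: "nat \<Rightarrow> ('a, 'b) max_sum"
  assume X: "Cauchy X"
  define F where "F p = fst (max_sum_prod p)" for p :: "('a, 'b) max_sum"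
  define G where "G p = snd (max_sum_prod p)" for p :: "('a, 'b) max_sum"
  have norm_eq: "norm (p - q) = max (norm (F p - F q)) (norm (G p - G q))" for p q
    unfolding F_def G_def by transfer auto
  have "Cauchy (\<lambda>n. F (X n))" "Cauchy (\<lambda>n. G (X n))"
    using X by (simp_all add: Cauchy_def dist_norm norm_eq) meson+
  then obtain x y where xy: "(\<lambda>n. F (X n)) \<longlonglongrightarrow> x" "(\<lambda>n. G (X n)) \<longlonglongrightarrow> y"
    using Cauchy_convergent_iff convergent_def by metis
  have FG: "F (Max_Sum (x, y)) = x" "G (Max_Sum (x, y)) = y"
    by (simp_all add: F_def G_def Max_Sum_inverse)
  have "(\<lambda>n. max (norm (F (X n) - x)) (norm (G (X n) - y))) \<longlonglongrightarrow> max (norm (0::'a)) (norm (0::'b))"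
    using xy by (intro tendsto_max tendsto_norm) (simp_all add: LIM_zero)
  then have "X \<longlonglongrightarrow> Max_Sum (x, y)"
    unfolding tendsto_dist_iff[of X] dist_norm norm_eq FG by simp
  then show "convergent X" by (auto simp: convergent_def)
qed

lift_definition cblinfun_dsum ::
  "('a::complex_normed_vector \<Rightarrow>\<^bsub>CL\<^esub> 'b::complex_normed_vector) \<Rightarrow>
    ('c::complex_normed_vector \<Rightarrow>\<^bsub>CL\<^esub> 'd::complex_normed_vector) \<Rightarrow>
    ('a, 'c) max_sum \<Rightarrow>\<^bsub>CL\<^esub> ('b, 'd) max_sum"  (infixr \<open>\<oplus>\<^sub>C\<close> 65)
  is "\<lambda>A B p. Max_Sum (A (fst (max_sum_prod p)), B (snd (max_sum_prod p)))"
proof (intro conjI allI)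
  fix A :: "'a \<Rightarrow> 'b" and B :: "'c \<Rightarrow> 'd"
  let ?T = "\<lambda>p. Max_Sum (A (fst (max_sum_prod p)), B (snd (max_sum_prod p)))"
  assume A: "bounded_linear A \<and> (\<forall>c x. A (c *\<^sub>C x) = c *\<^sub>C A x)"
    and B: "bounded_linear B \<and> (\<forall>c x. B (c *\<^sub>C x) = c *\<^sub>C B x)"
  interpret A: bounded_linear A using A by simp
  interpret B: bounded_linear B using B by simp
  show "bounded_linear ?T"
  proof (rule bounded_linear_intro[where K = "max (onorm A) (onorm B)"])
    fix p q :: "('a, 'c) max_sum" and r :: real
    show "?T (p + q) = ?T p + ?T q"
      by (simp add: max_sum_expand Max_Sum_inverse plus_max_sum.rep_eq A.add B.add split: prod.splits)
    show "?T (r *\<^sub>R p) = r *\<^sub>R ?T p"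
      by (simp add: max_sum_expand Max_Sum_inverse scaleR_max_sum.rep_eq A.scaleR B.scaleR
          split: prod.splits)
    show "norm (?T p) \<le> norm p * max (onorm A) (onorm B)"
    proof -
      obtain x y where p: "max_sum_prod p = (x, y)" by fastforce
      have "norm (A x) \<le> max (norm x) (norm y) * max (onorm A) (onorm B)"
        by (rule order_trans[OF onorm[OF A.bounded_linear]], subst mult.commute, rule mult_mono)
          (auto simp: le_max_iff_disj onorm_pos_le A.bounded_linear)
      moreover have "norm (B y) \<le> max (norm x) (norm y) * max (onorm A) (onorm B)"
        by (rule order_trans[OF onorm[OF B.bounded_linear]], subst mult.commute, rule mult_mono)
          (auto simp: le_max_iff_disj onorm_pos_le B.bounded_linear)
      ultimately show ?thesis
        by (simp add: norm_max_sum.rep_eq Max_Sum_inverse p)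
    qed
  qed
  show "?T (c *\<^sub>C p) = c *\<^sub>C ?T p" for c p
    using A B
    by (simp add: max_sum_expand Max_Sum_inverse scaleC_max_sum.rep_eq split: prod.splits)
qed


section \<open>Uniform approximate projections and the associated operator algebras\<close>

type_synonym 'a endo = "'a \<Rightarrow>\<^bsub>CL\<^esub> 'a"

text \<open>The complementary projections, written \<open>Q\<^sub>n = I - P\<^sub>n\<close> in the literature.\<close>

definition cproj :: "(nat \<Rightarrow> 'a::complex_normed_vector endo) \<Rightarrow> nat \<Rightarrow> 'a endo"
  where "cproj P n = cblinfun_id - P n"

definition uniform_approx_proj :: "(nat \<Rightarrow> 'a::complex_banach endo) \<Rightarrow> bool"
  where "uniform_approx_proj P \<longleftrightarrow>
    (\<forall>n. P n o\<^sub>C P n = P n) \<and>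
    (\<forall>n. P n = P n o\<^sub>C P (Suc n) \<and> P n = P (Suc n) o\<^sub>C P n) \<and>
    (\<forall>n. norm (P n) = 1 \<and> norm (cproj P n) = 1) \<and>
    bdd_above {norm (\<Sum>n\<in>U. P (Suc n) - P n) | U. finite U}"

definition Pcompact :: "(nat \<Rightarrow> 'a::complex_banach endo) \<Rightarrow> 'a endo set"
  where "Pcompact P =
    {K. (\<lambda>n. norm (cproj P n o\<^sub>C K) + norm (K o\<^sub>C cproj P n)) \<longlonglongrightarrow> 0}"

definition Palg :: "(nat \<Rightarrow> 'a::complex_banach endo) \<Rightarrow> 'a endo set"
  where "Palg P = {A. \<forall>K\<in>Pcompact P. A o\<^sub>C K \<in> Pcompact P \<and> K o\<^sub>C A \<in> Pcompact P}"

definition Pring :: "(nat \<Rightarrow> 'a::complex_banach endo) \<Rightarrow> 'a endo ring"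
  where "Pring P =
    \<lparr>carrier = Palg P, mult = (o\<^sub>C), one = cblinfun_id, zero = 0, add = (+)\<rparr>"

definition Pquot :: "(nat \<Rightarrow> 'a::complex_banach endo) \<Rightarrow> 'a endo set ring"
  where "Pquot P = Pring P Quot Pcompact P"

definition Pcoset :: "(nat \<Rightarrow> 'a::complex_banach endo) \<Rightarrow> 'a endo \<Rightarrow> 'a endo set"
  where "Pcoset P A = Pcompact P +>\<^bsub>Pring P\<^esub> A"

definition P_Fredholm :: "(nat \<Rightarrow> 'a::complex_banach endo) \<Rightarrow> 'a endo \<Rightarrow> bool"
  where "P_Fredholm P A \<longleftrightarrow> A \<in> Palg P \<and> Pcoset P A \<in> Units (Pquot P)"

text \<open>The quotient norm: for \<open>C = B + K\<close> with \<open>K\<close> the ideal, the infimum of all \<open>\<parallel>B + k\<parallel>\<close>, \<open>k \<in> K\<close>.\<close>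

definition coset_norm :: "'a::complex_banach endo set \<Rightarrow> real"
  where "coset_norm C = (INF B\<in>C. norm B)"

lemma Pcompact_iff:
  "K \<in> Pcompact P \<longleftrightarrow>
    (\<lambda>n. norm (cproj P n o\<^sub>C K)) \<longlonglongrightarrow> 0 \<and> (\<lambda>n. norm (K o\<^sub>C cproj P n)) \<longlonglongrightarrow> 0"
proof (intro iffI conjI)
  assume "K \<in> Pcompact P"
  then have lim: "(\<lambda>n. norm (cproj P n o\<^sub>C K) + norm (K o\<^sub>C cproj P n)) \<longlonglongrightarrow> 0"
    by (simp add: Pcompact_def)
  show "(\<lambda>n. norm (cproj P n o\<^sub>C K)) \<longlonglongrightarrow> 0"
    by (rule tendsto_sandwich[OF _ _ tendsto_const lim]) auto
  show "(\<lambda>n. norm (K o\<^sub>C cproj P n)) \<longlonglongrightarrow> 0"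
    by (rule tendsto_sandwich[OF _ _ tendsto_const lim]) auto
next
  assume "(\<lambda>n. norm (cproj P n o\<^sub>C K)) \<longlonglongrightarrow> 0 \<and> (\<lambda>n. norm (K o\<^sub>C cproj P n)) \<longlonglongrightarrow> 0"
  then show "K \<in> Pcompact P"
    using tendsto_add[of "\<lambda>n. norm (cproj P n o\<^sub>C K)" 0 sequentially "\<lambda>n. norm (K o\<^sub>C cproj P n)" 0]
    by (simp add: Pcompact_def)
qed

lemma Pcompact_zero: "0 \<in> Pcompact P"
  by (simp add: Pcompact_def cblinfun_compose_zero)

lemma Pcompact_uminus: "K \<in> Pcompact P \<Longrightarrow> - K \<in> Pcompact P"
  by (simp add: Pcompact_def cblinfun_compose_minus)

lemma Pcompact_add:
  assumes "K \<in> Pcompact P" "L \<in> Pcompact P"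
  shows "K + L \<in> Pcompact P"
proof -
  have "(\<lambda>n. norm (cproj P n o\<^sub>C (K + L))) \<longlonglongrightarrow> 0"
    using assms tendsto_norm_zero[OF tendsto_add_zero[OF tendsto_norm_zero_cancel tendsto_norm_zero_cancel]]
    by (auto simp: Pcompact_iff cblinfun_compose_add_right)
  moreover have "(\<lambda>n. norm ((K + L) o\<^sub>C cproj P n)) \<longlonglongrightarrow> 0"
    using assms tendsto_norm_zero[OF tendsto_add_zero[OF tendsto_norm_zero_cancel tendsto_norm_zero_cancel]]
    by (auto simp: Pcompact_iff cblinfun_compose_add_left)
  ultimately show ?thesis by (simp add: Pcompact_iff)
qed

lemma Pcompact_compose:
  assumes "K \<in> Pcompact P" "L \<in> Pcompact P"
  shows "K o\<^sub>C L \<in> Pcompact P"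
proof -
  have "(\<lambda>n. norm (cproj P n o\<^sub>C K) * norm L) \<longlonglongrightarrow> 0" "(\<lambda>n. norm K * norm (L o\<^sub>C cproj P n)) \<longlonglongrightarrow> 0"
    using assms by (auto simp: Pcompact_iff intro: tendsto_mult_left_zero tendsto_mult_right_zero)
  note lim = this
  have "(\<lambda>n. norm (cproj P n o\<^sub>C (K o\<^sub>C L))) \<longlonglongrightarrow> 0"
    by (rule tendsto_sandwich[OF _ _ tendsto_const lim(1)])
      (auto simp: norm_cblinfun_compose simp flip: cblinfun_compose_assoc)
  moreover have "(\<lambda>n. norm ((K o\<^sub>C L) o\<^sub>C cproj P n)) \<longlonglongrightarrow> 0"
    by (rule tendsto_sandwich[OF _ _ tendsto_const lim(2)])
      (auto simp: norm_cblinfun_compose cblinfun_compose_assoc)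
  ultimately show ?thesis by (simp add: Pcompact_iff)
qed

lemma Pcompact_subset_Palg: "Pcompact P \<subseteq> Palg P"
  by (auto simp: Palg_def Pcompact_compose)

lemma ring_Pring: "Ring.ring (Pring P)"
proof (rule ringI)
  show "abelian_group (Pring P)"
  proof (rule abelian_groupI)
    fix A assume "A \<in> carrier (Pring P)"
    then show "\<exists>B\<in>carrier (Pring P). B \<oplus>\<^bsub>Pring P\<^esub> A = \<zero>\<^bsub>Pring P\<^esub>"
      by (intro bexI[where x = "- A"])
        (auto simp: Pring_def Palg_def cblinfun_compose_minus intro: Pcompact_uminus)
  qed (auto simp: Pring_def Palg_def cblinfun_compose_zero cblinfun_compose_add_left
      cblinfun_compose_add_right intro: Pcompact_add Pcompact_zero)
  show "Group.monoid (Pring P)"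
  proof (rule monoidI)
    show "A \<otimes>\<^bsub>Pring P\<^esub> B \<in> carrier (Pring P)"
      if "A \<in> carrier (Pring P)" "B \<in> carrier (Pring P)" for A B
      using that by (auto simp: Pring_def Palg_def cblinfun_compose_assoc)
        (auto simp flip: cblinfun_compose_assoc)
  qed (auto simp: Pring_def Palg_def cblinfun_compose_id cblinfun_compose_assoc)
qed (auto simp: Pring_def cblinfun_compose_add_left cblinfun_compose_add_right)

lemma ideal_Pcompact: "ideal (Pcompact P) (Pring P)"
proof (rule idealI[OF ring_Pring])
  interpret Ring.ring "Pring P" by (rule ring_Pring)
  show "subgroup (Pcompact P) (add_monoid (Pring P))"
  proof (rule add.subgroupI)
    show "Pcompact P \<subseteq> carrier (Pring P)"
      using Pcompact_subset_Palg by (auto simp: Pring_def)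
    show "Pcompact P \<noteq> {}"
      using Pcompact_zero by blast
    show "\<ominus>\<^bsub>Pring P\<^esub> K \<in> Pcompact P" if "K \<in> Pcompact P" for K
    proof -
      have "- K \<in> Pcompact P" by (rule Pcompact_uminus) fact
      moreover from this have "\<ominus>\<^bsub>Pring P\<^esub> K = - K"
        using that Pcompact_subset_Palg by (intro minus_equality) (auto simp: Pring_def)
      ultimately show ?thesis by simp
    qed
  qed (auto simp: Pring_def intro: Pcompact_add)
qed (auto simp: Pring_def Palg_def)


section \<open>Lower norms and Fredholm operators\<close>

text \<open>\<open>lower_norm_on S B\<close> is the lower norm of the restriction of \<open>B\<close> to the subspace \<open>S\<close>. As
  an infimum of reals it is meaningful only for \<open>S \<noteq> {0}\<close>.\<close>

definition lower_norm_on ::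
    "'a set \<Rightarrow> ('a::complex_normed_vector \<Rightarrow>\<^bsub>CL\<^esub> 'b::complex_normed_vector) \<Rightarrow> real"
  where "lower_norm_on S B = (INF x\<in>{x \<in> S. norm x = 1}. norm (B x))"

definition mu_tilde :: "(nat \<Rightarrow> 'a::complex_banach endo) \<Rightarrow> 'a endo \<Rightarrow> real"
  where "mu_tilde P A = lim (\<lambda>m. lower_norm_on (range (cproj P m)) A)"

definition adjoint_seq :: "(nat \<Rightarrow> 'a::complex_banach endo) \<Rightarrow> nat \<Rightarrow> 'a cdual endo"
  where "adjoint_seq P n = cblinfun_adjoint (P n)"

definition dsum_seq :: "(nat \<Rightarrow> 'a::complex_banach endo) \<Rightarrow> (nat \<Rightarrow> 'b::complex_banach endo) \<Rightarrow>
    nat \<Rightarrow> ('a, 'b) max_sum endo"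
  where "dsum_seq P R n = P n \<oplus>\<^sub>C R n"

definition mu :: "(nat \<Rightarrow> 'a::complex_banach endo) \<Rightarrow> 'a endo \<Rightarrow> real"
  where "mu P A = min (mu_tilde P A) (mu_tilde (adjoint_seq P) (cblinfun_adjoint A))"

definition nu_ess :: "(nat \<Rightarrow> 'a::complex_banach endo) \<Rightarrow> 'a endo \<Rightarrow> real"
  where "nu_ess P B = (SUP K\<in>Pcompact P. lower_norm_on UNIV (B + K))"

text \<open>Finite-dimensional kernel, and range of finite codimension: finitely many vectors together
  with the range span the space. Spans are over the complex numbers.\<close>

definition fredholm :: "('a::complex_banach \<Rightarrow>\<^bsub>CL\<^esub> 'b::complex_banach) \<Rightarrow> bool"
  where "fredholm A \<longleftrightarrow>
    (\<exists>S. finite S \<and> {x. A x = 0} \<subseteq> complex_vector.span S) \<and>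
    (\<exists>S. finite S \<and> complex_vector.span (range A \<union> S) = UNIV)"

end

theory Submission
  imports Defs "HOL-Probability.Discrete_Topology"
begin

text \<open>
  Call an operator \<open>R\<close> in the algebra of \<open>\<P>\<close> a regularizer of \<open>A\<close> if \<open>R A - I\<close> and \<open>A R - I\<close> are \<open>\<P>\<close>-compact; the regularizers of \<open>A\<close>
  form the inverse coset, and \<open>q\<close>, the infimum of their norms, is its quotient norm. All the
  quantities in question are squeezed into the cyclic chain
  \<open>1/q \<le> \<nu>\<^sub>e\<^sub>s\<^sub>s(A \<oplus> A\<^sup>*) \<le> \<mu>\<^sub>\<sim>(A \<oplus> A\<^sup>*) = \<mu>(A) \<le> \<mu>\<^sub>\<sim>(A) \<le> 1/q\<close>, where \<open>\<mu>\<^sub>\<sim>\<close> stands for \<^const>\<open>mu_tilde\<close>.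

  The middle part is formal. On \<open>im Q\<^sub>m\<close> with \<open>m\<close> large a \<open>\<P>\<close>-compact perturbation is negligible, which
  gives the second inequality (\<open>nu_ess_le_mu_tilde\<close>); the lower norm of a direct sum under the maximum
  norm is the smaller of the two lower norms, which gives the equality (\<open>mu_tilde_dsum\<close>).

  The last inequality (\<open>mu_tilde_le_inverse_coset_norm\<close>) holds because every compression \<open>Q\<^sub>n R Q\<^sub>m\<close> of a
  regularizer is again a regularizer, while \<open>A Q\<^sub>n R Q\<^sub>m\<close> differs from \<open>Q\<^sub>m\<close> by \<open>(A R - I) Q\<^sub>m - A P\<^sub>n R Q\<^sub>m\<close>,
  which tends to \<open>0\<close> as \<open>m\<close> grows. Hence \<open>A\<close>, restricted to \<open>im Q\<^sub>n\<close>, cannot have a lower norm above \<open>1/q\<close>.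

  The first inequality is the substance. It is enough to find one \<open>\<P>\<close>-compact perturbation \<open>D'\<close> of
  \<open>A \<oplus> A\<^sup>*\<close> that is bounded below by any positive constant whatsoever: then \<open>D' (Q\<^sub>n + t P\<^sub>n)\<close> is still such a
  perturbation, and for large \<open>n\<close> and \<open>t\<close> its lower norm is at least almost \<open>1 / \<parallel>R\<parallel>\<close>. Indeed, the large factor
  \<open>t\<close> makes the contribution of \<open>im P\<^sub>n\<close> harmless, and on \<open>im Q\<^sub>n\<close> the left regularizer \<open>R \<oplus> R\<^sup>*\<close> controls
  everything (\<open>nu_ess_ge\<close>). To find \<open>D'\<close>, replace \<open>A\<close> by the Fredholm operator \<open>B\<close> in its coset. The
  operator \<open>B \<oplus> B\<^sup>*\<close> has index zero, as \<open>ker B\<^sup>*\<close> is in duality with the cokernel of \<open>B\<close> and \<open>ker B\<close> with that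
  of \<open>B\<^sup>*\<close>, and an off-diagonal operator of finite rank matching kernels with cokernels
  makes it bounded below (\<open>offdiag_perturbation_bounded_below\<close>). Since the kernel and a complement of the
  range of \<open>B\<close> are seen through the \<open>\<P>\<close>-compact operators \<open>R B - I\<close> and \<open>B R - I\<close>, the finite-rank
  operator can be chosen \<open>\<P>\<close>-compact (\<open>fredholm_cokernel_system\<close>, \<open>fredholm_kernel_system\<close>).

  Two theorems on Banach spaces enter: bounded functionals separate points, which makes \<open>\<P>\<^sup>*\<close> nontrivial
  and produces dual bases of kernels, and the open mapping theorem, which gives closed range together with
  quantitative bounds.
\<close>

section \<open>Linear functionals separate points\<close>

text \<open>
  The Hahn-Banach theorem is obtained without extending functionals from subspaces: a sublinear
  functional that is minimal in the pointwise order is linear, and minimal ones exist by Zorn's lemma.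
\<close>

definition sublinear :: "('a::real_vector \<Rightarrow> real) \<Rightarrow> bool"
  where "sublinear q \<longleftrightarrow>
    (\<forall>x y. q (x + y) \<le> q x + q y) \<and> (\<forall>r x. r \<ge> 0 \<longrightarrow> q (r *\<^sub>R x) = r * q x)"

lemma sublinear_add: "sublinear q \<Longrightarrow> q (x + y) \<le> q x + q y"
  and sublinear_scaleR: "sublinear q \<Longrightarrow> r \<ge> 0 \<Longrightarrow> q (r *\<^sub>R x) = r * q x"
  by (simp_all add: sublinear_def)

lemma sublinear_zero: "sublinear q \<Longrightarrow> q 0 = 0"
  using sublinear_scaleR[of q 0 0] by simp

lemma sublinear_ge_minus: "sublinear q \<Longrightarrow> - q (- x) \<le> q x"
  using sublinear_add[of q x "- x"] by (simp add: sublinear_zero)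

text \<open>Homogeneity only has to be checked in one direction, since \<open>r\<close> may be replaced by \<open>1 / r\<close>.\<close>

lemma sublinearI:
  fixes q :: "'a::real_vector \<Rightarrow> real"
  assumes add: "\<And>x y. q (x + y) \<le> q x + q y"
    and scale: "\<And>r x. r > 0 \<Longrightarrow> q (r *\<^sub>R x) \<le> r * q x"
    and zero: "q 0 = 0"
  shows "sublinear q"
  unfolding sublinear_def
proof (intro conjI allI impI)
  fix r :: real and x assume "r \<ge> 0"
  show "q (r *\<^sub>R x) = r * q x"
  proof (cases "r = 0")
    case False
    with \<open>r \<ge> 0\<close> have r: "r > 0" by simp
    have "q ((1 / r) *\<^sub>R (r *\<^sub>R x)) \<le> 1 / r * q (r *\<^sub>R x)"
      using scale[of "1 / r" "r *\<^sub>R x"] r by simp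
    then have "r * q x \<le> q (r *\<^sub>R x)" using r by (simp add: field_simps)
    with scale[OF r] show ?thesis by (simp add: antisym)
  qed (simp add: zero)
qed (rule add)

text \<open>
  The largest sublinear minorant of \<open>q\<close> that is at most \<open>- q y\<close> at \<open>- y\<close>. If \<open>q\<close> is minimal it equals
  \<open>slide q y\<close>, and the term \<open>t = 1\<close> of the infimum then says that \<open>q\<close> is additive.
\<close>

definition slide :: "('a::real_vector \<Rightarrow> real) \<Rightarrow> 'a \<Rightarrow> 'a \<Rightarrow> real"
  where "slide q y x = (INF t\<in>{0..}. q (x + t *\<^sub>R y) - t * q y)"

lemma slide_le:
  assumes "sublinear q" "t \<ge> 0"
  shows "slide q y x \<le> q (x + t *\<^sub>R y) - t * q y"
  unfolding slide_def
proof (rule cINF_lower)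
  have "- q (- x) \<le> q (x + t *\<^sub>R y) - t * q y" if "t \<ge> 0" for t
    using sublinear_add[OF assms(1), of "x + t *\<^sub>R y" "- x"] sublinear_scaleR[OF assms(1) that, of y]
    by simp
  then show "bdd_below ((\<lambda>t. q (x + t *\<^sub>R y) - t * q y) ` {0..})"
    by (intro bdd_belowI2[where m = "- q (- x)"]) simp
qed (use assms in simp)

lemma slide_greatest:
  "(\<And>t. t \<ge> 0 \<Longrightarrow> b \<le> q (x + t *\<^sub>R y) - t * q y) \<Longrightarrow> b \<le> slide q y x"
  unfolding slide_def by (rule cINF_greatest) auto

lemma sublinear_slide:
  assumes q: "sublinear q"
  shows "sublinear (slide q y)"
proof (rule sublinearI)
  fix x x'
  have "slide q y (x + x') - slide q y x' \<le> slide q y x"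
  proof (rule slide_greatest)
    fix t :: real assume t: "t \<ge> 0"
    have "slide q y (x + x') - (q (x + t *\<^sub>R y) - t * q y) \<le> slide q y x'"
    proof (rule slide_greatest)
      fix s :: real assume s: "s \<ge> 0"
      have "slide q y (x + x') \<le> q ((x + x') + (t + s) *\<^sub>R y) - (t + s) * q y"
        using s t by (intro slide_le q) simp
      also have "(x + x') + (t + s) *\<^sub>R y = (x + t *\<^sub>R y) + (x' + s *\<^sub>R y)"
        by (simp add: algebra_simps)
      also have "q \<dots> \<le> q (x + t *\<^sub>R y) + q (x' + s *\<^sub>R y)"
        by (rule sublinear_add[OF q])
      finally show "slide q y (x + x') - (q (x + t *\<^sub>R y) - t * q y) \<le> q (x' + s *\<^sub>R y) - s * q y"
        by (simp add: algebra_simps)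
    qed
    then show "slide q y (x + x') - slide q y x' \<le> q (x + t *\<^sub>R y) - t * q y" by simp
  qed
  then show "slide q y (x + x') \<le> slide q y x + slide q y x'" by simp
next
  fix r :: real and x assume r: "r > 0"
  have "slide q y (r *\<^sub>R x) / r \<le> slide q y x"
  proof (rule slide_greatest)
    fix t :: real assume t: "t \<ge> 0"
    have "slide q y (r *\<^sub>R x) \<le> q (r *\<^sub>R x + (r * t) *\<^sub>R y) - (r * t) * q y"
      using r t by (intro slide_le q) simp
    also have "r *\<^sub>R x + (r * t) *\<^sub>R y = r *\<^sub>R (x + t *\<^sub>R y)"
      by (simp add: scaleR_add_right)
    also have "q \<dots> = r * q (x + t *\<^sub>R y)"
      using r by (intro sublinear_scaleR[OF q]) simp
    finally show "slide q y (r *\<^sub>R x) / r \<le> q (x + t *\<^sub>R y) - t * q y"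
      using r by (simp add: field_simps)
  qed
  then show "slide q y (r *\<^sub>R x) \<le> r * slide q y x"
    using r by (simp add: field_simps)
next
  show "slide q y 0 = 0"
  proof (rule antisym)
    show "slide q y 0 \<le> 0" using slide_le[OF q, of 0 y 0] by (simp add: sublinear_zero[OF q])
    show "0 \<le> slide q y 0" by (rule slide_greatest) (simp add: sublinear_scaleR[OF q])
  qed
qed

lemma slide_le_self: "sublinear q \<Longrightarrow> slide q y \<le> q"
  using slide_le[of q 0 y] by (auto simp: le_fun_def)

lemma sublinear_INF_chain:
  fixes C :: "('a::real_vector \<Rightarrow> real) set"
  assumes ne: "C \<noteq> {}" and sub: "\<And>q. q \<in> C \<Longrightarrow> sublinear q"
    and le: "\<And>q. q \<in> C \<Longrightarrow> q \<le> p"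
    and chain: "\<And>q q'. q \<in> C \<Longrightarrow> q' \<in> C \<Longrightarrow> q \<le> q' \<or> q' \<le> q"
  shows "sublinear (\<lambda>x. INF q\<in>C. q x)" and "\<And>q x. q \<in> C \<Longrightarrow> (INF q\<in>C. q x) \<le> q x"
proof -
  show lower: "(INF q\<in>C. q x) \<le> q x" if "q \<in> C" for q x
  proof (rule cINF_lower[OF _ that])
    show "bdd_below ((\<lambda>q. q x) ` C)"
    proof (rule bdd_belowI2)
      fix q assume "q \<in> C"
      then show "- p (- x) \<le> q x"
        using le_funD[OF le, of q "- x"] sublinear_ge_minus[OF sub, of q x] by simp
    qed
  qed
  show "sublinear (\<lambda>x. INF q\<in>C. q x)"
  proof (rule sublinearI)
    fix x y
    have "(INF q\<in>C. q (x + y)) - (INF q\<in>C. q y) \<le> (INF q\<in>C. q x)"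
    proof (rule cINF_greatest[OF ne])
      fix q assume q: "q \<in> C"
      have "(INF q\<in>C. q (x + y)) - q x \<le> (INF q\<in>C. q y)"
      proof (rule cINF_greatest[OF ne])
        fix q' assume q': "q' \<in> C"
        obtain m where m: "m \<in> C" "m \<le> q" "m \<le> q'"
          using chain[OF q q'] q q' by blast
        have "(INF q\<in>C. q (x + y)) \<le> m x + m y"
          using lower[OF m(1), of "x + y"] sublinear_add[OF sub[OF m(1)], of x y] by simp
        also have "\<dots> \<le> q x + q' y"
          using m by (simp add: le_fun_def add_mono)
        finally show "(INF q\<in>C. q (x + y)) - q x \<le> q' y" by simp
      qed
      then show "(INF q\<in>C. q (x + y)) - (INF q\<in>C. q y) \<le> q x" by simp
    qed
    then show "(INF q\<in>C. q (x + y)) \<le> (INF q\<in>C. q x) + (INF q\<in>C. q y)" by simp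
  next
    fix r :: real and x :: 'a assume r: "r > 0"
    have "(INF q\<in>C. q (r *\<^sub>R x)) / r \<le> (INF q\<in>C. q x)"
    proof (rule cINF_greatest[OF ne])
      fix q assume "q \<in> C"
      then show "(INF q\<in>C. q (r *\<^sub>R x)) / r \<le> q x"
        using lower[of q "r *\<^sub>R x"] sublinear_scaleR[OF sub, of q r x] r by (simp add: field_simps)
    qed
    then show "(INF q\<in>C. q (r *\<^sub>R x)) \<le> r * (INF q\<in>C. q x)"
      using r by (simp add: field_simps)
  next
    have "(INF q\<in>C. q 0) = (INF q\<in>C. 0::real)"
      using sublinear_zero[OF sub] by (intro INF_cong) auto
    then show "(INF q\<in>C. q 0) = (0::real)" using ne by simp
  qed
qed

lemma minimal_sublinear_exists:
  fixes p :: "'a::real_vector \<Rightarrow> real"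
  assumes "sublinear p"
  obtains m where "sublinear m" "m \<le> p" "\<And>q. sublinear q \<Longrightarrow> q \<le> m \<Longrightarrow> q = m"
proof -
  let ?A = "{q. sublinear q \<and> q \<le> p}"
  have "\<exists>m\<in>?A. \<forall>q\<in>?A. q \<le> m \<longrightarrow> q = m"
  proof (rule predicate_Zorn)
    show "partial_order_on ?A (relation_of (\<lambda>m q. q \<le> m) ?A)"
      by (rule partial_order_on_relation_ofI) auto
    fix C assume "C \<in> Chains (relation_of (\<lambda>m q. q \<le> m) ?A)"
    then have C: "\<And>q q'. q \<in> C \<Longrightarrow> q' \<in> C \<Longrightarrow> sublinear q \<and> q \<le> p \<and> (q \<le> q' \<or> q' \<le> q)"
      by (auto simp: Chains_def relation_of_def)
    show "\<exists>u\<in>?A. \<forall>q\<in>C. u \<le> q"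
    proof (cases "C = {}")
      case False
      then obtain q0 where q0: "q0 \<in> C" by blast
      note inf = sublinear_INF_chain[OF False, of p]
      have sub: "sublinear (\<lambda>x. INF q\<in>C. q x)"
        by (rule inf(1)) (use C in blast)+
      have lower: "(\<lambda>x. INF q\<in>C. q x) \<le> q" if "q \<in> C" for q
        unfolding le_fun_def by (intro allI inf(2) that) (use C in blast)+
      then have "(\<lambda>x. INF q\<in>C. q x) \<le> p"
        using order_trans[OF lower[OF q0], of p] C q0 by blast
      with sub lower show ?thesis by (intro bexI[where x = "\<lambda>x. INF q\<in>C. q x"]) auto
    qed (use assms in auto)
  qed
  then obtain m where m: "m \<in> ?A" and min: "\<forall>q\<in>?A. q \<le> m \<longrightarrow> q = m" by blast
  show thesis
  proof (rule that[of m])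
    fix q assume "sublinear q" "q \<le> m"
    with m min show "q = m" by (metis (mono_tags, lifting) mem_Collect_eq order_trans)
  qed (use m in auto)
qed

lemma minimal_sublinear_linear:
  fixes m :: "'a::real_vector \<Rightarrow> real"
  assumes m: "sublinear m" and min: "\<And>q. sublinear q \<Longrightarrow> q \<le> m \<Longrightarrow> q = m"
  shows "linear m"
proof -
  have add: "m (x + y) = m x + m y" for x y
  proof (rule antisym[OF sublinear_add[OF m]])
    have "slide m y = m"
      by (intro min sublinear_slide slide_le_self m)
    then show "m x + m y \<le> m (x + y)"
      using slide_le[OF m, of 1 y x] by simp
  qed
  then have neg: "m (- x) = - m x" for x
    using add[of x "- x"] by (simp add: sublinear_zero[OF m])
  have "m (r *\<^sub>R x) = r * m x" for r x
  proof (cases "r \<ge> 0")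
    case False
    then have "m (- ((- r) *\<^sub>R x)) = - ((- r) * m x)"
      unfolding neg by (subst sublinear_scaleR[OF m]) auto
    then show ?thesis by simp
  qed (rule sublinear_scaleR[OF m])
  with add show ?thesis by (intro linearI) auto
qed

text \<open>
  A linear minorant of \<open>slide p y\<close> rather than of \<open>p\<close> is taken in order to force equality at \<open>y\<close>.
\<close>

theorem hahn_banach_sublinear:
  fixes p :: "'a::real_vector \<Rightarrow> real"
  assumes p: "sublinear p"
  obtains \<phi> where "linear \<phi>" "\<And>x. \<phi> x \<le> p x" "\<phi> y = p y"
proof -
  obtain m where m: "sublinear m" "m \<le> slide p y" "\<And>q. sublinear q \<Longrightarrow> q \<le> m \<Longrightarrow> q = m"
    using minimal_sublinear_exists[OF sublinear_slide[OF p]] by blast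
  have lin: "linear m" by (rule minimal_sublinear_linear[OF m(1,3)])
  have le: "m x \<le> p x" for x
    using le_funD[OF order_trans[OF m(2) slide_le_self[OF p]]] .
  have "m (- y) \<le> - p y"
    using order_trans[OF le_funD[OF m(2), of "- y"] slide_le[OF p, of 1 y "- y"]]
    by (simp add: sublinear_zero[OF p])
  then have "p y \<le> m y" by (simp add: linear_neg[OF lin])
  with le[of y] have "m y = p y" by simp
  with lin le show thesis by (rule that)
qed

text \<open>
  A real functional \<open>\<phi>\<close> is the real part of the complex functional \<open>z \<mapsto> \<phi> z - \<i> \<phi> (\<i> z)\<close>. The crude
  bound by twice the norm suffices for separating points.
\<close>

lemma cdual_separates:
  fixes x :: "'a::complex_normed_vector"
  assumes "x \<noteq> 0"
  obtains f :: "'a cdual" where "f x \<noteq> 0"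
proof -
  have "sublinear (norm :: 'a \<Rightarrow> real)"
    by (rule sublinearI) (simp_all add: norm_triangle_ineq)
  then obtain \<phi> :: "'a \<Rightarrow> real" where \<phi>: "linear \<phi>" "\<And>z. \<phi> z \<le> norm z" "\<phi> x = norm x"
    using hahn_banach_sublinear by metis
  interpret linear \<phi> by fact
  have abs: "\<bar>\<phi> z\<bar> \<le> norm z" for z
    using \<phi>(2)[of z] \<phi>(2)[of "- z"] by (simp add: neg)
  define F where "F z = Complex (\<phi> z) (- \<phi> (\<i> *\<^sub>C z))" for z
  have scaleC: "\<phi> (c *\<^sub>C z) = Re c * \<phi> z + Im c * \<phi> (\<i> *\<^sub>C z)" for c z
  proof -
    have "c *\<^sub>C z = (complex_of_real (Re c) + complex_of_real (Im c) * \<i>) *\<^sub>C z"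
      by (simp add: complex_eq mult.commute)
    also have "\<dots> = Re c *\<^sub>R z + Im c *\<^sub>R (\<i> *\<^sub>C z)"
      by (simp only: scaleC_add_left scaleR_scaleC scaleC_scaleC)
    finally show ?thesis by (simp add: add scale)
  qed
  have "bounded_linear F"
  proof (rule bounded_linear_intro[where K = 2])
    show "F (u + v) = F u + F v" for u v
      by (simp add: F_def add scaleC_add_right complex_eq_iff)
    show "F (r *\<^sub>R u) = r *\<^sub>R F u" for r u
    proof -
      have "\<i> *\<^sub>C (r *\<^sub>R u) = r *\<^sub>R (\<i> *\<^sub>C u)"
        by (simp add: scaleR_scaleC scaleC_scaleC mult.commute)
      then show ?thesis by (simp add: F_def scale complex_eq_iff)
    qed
    show "norm (F u) \<le> norm u * 2" for u
      using cmod_le[of "F u"] abs[of u] abs[of "\<i> *\<^sub>C u"] by (simp add: F_def norm_scaleC)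
  qed
  moreover have "F (c *\<^sub>C z) = c *\<^sub>C F z" for c z
  proof -
    have "\<phi> (\<i> *\<^sub>C c *\<^sub>C z) = Re c * \<phi> (\<i> *\<^sub>C z) - Im c * \<phi> z"
      using scaleC[of "\<i> * c" z] by (simp add: scaleC_scaleC)
    then show ?thesis
      by (simp add: F_def scaleC_complex_def complex_eq_iff scaleC[of c z])
  qed
  ultimately have "cblinfun_apply (CBlinfun F) = F"
    by (intro CBlinfun_inverse) auto
  moreover have "F x \<noteq> 0"
    using assms by (simp add: F_def \<phi>(3) complex_eq_iff)
  ultimately show thesis by (intro that[of "CBlinfun F"]) simp
qed

section \<open>The open mapping theorem\<close>

text \<open>
  By Baire's theorem the closure of the image of some ball has an interior point \<open>z\<close>. Taking
  half the difference of approximate preimages of \<open>z + w\<close> and \<open>z - w\<close> moves the interior point to the origin, and scaling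
  then covers all \<open>y\<close>.
\<close>

lemma surj_approximate_preimage:
  fixes T :: "'a::real_normed_vector \<Rightarrow> 'b::banach"
  assumes T: "bounded_linear T" and surj: "surj T"
  obtains M where "M > 0" "\<And>y \<delta>. \<delta> > 0 \<Longrightarrow> \<exists>x. norm (T x - y) < \<delta> \<and> norm x \<le> M * norm y"
proof -
  interpret bounded_linear T by fact
  define E where "E n = closure (T ` cball 0 (real n))" for n :: nat
  have "(\<Union>n. E n) = UNIV"
  proof -
    have "y \<in> (\<Union>n. E n)" for y
    proof -
      obtain x where x: "T x = y" using surj by (metis surjD)
      obtain n where "norm x \<le> real n" using real_arch_simple by blast
      with x have "y \<in> E n"
        unfolding E_def by (intro subsetD[OF closure_subset]) (auto intro!: image_eqI[of _ _ x])
      then show ?thesis by blast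
    qed
    then show ?thesis by blast
  qed
  have "\<exists>n. interior (E n) \<noteq> {}"
  proof (rule ccontr)
    assume "\<not> ?thesis"
    then have empty: "interior (E n) = {}" for n by blast
    have "Met_TC.mtopology interior_of \<Union> (range E) = {}"
    proof (rule Met_TC.metric_Baire_category_alt)
      show "Met_TC.mcomplete TYPE('b)" by (simp add: complete_UNIV)
      show "closedin Met_TC.mtopology S \<and> Met_TC.mtopology interior_of S = {}"
        if "S \<in> range E" for S :: "'b set"
        using that empty by (auto simp: E_def)
    qed simp
    then have "interior (\<Union> (range E)) = {}" by simp
    with \<open>(\<Union>n. E n) = UNIV\<close> show False by simp
  qed
  then obtain n z e where e: "e > 0" and ball: "ball z e \<subseteq> E n"
    by (metis all_not_in_conv mem_interior)
  have near: "\<exists>x. norm (T x - w) < \<delta> \<and> norm x \<le> real n" if w: "norm w < e" and \<delta>: "\<delta> > 0" for w \<delta>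
  proof -
    have "z + w \<in> E n" "z - w \<in> E n"
      using ball w by (auto simp: dist_norm)
    then obtain x1 x2 where "x1 \<in> cball 0 (real n)" "x2 \<in> cball 0 (real n)"
      "dist (T x1) (z + w) < \<delta>" "dist (T x2) (z - w) < \<delta>"
      using \<delta> unfolding E_def closure_approachable by blast
    then have x: "norm x1 \<le> real n" "norm x2 \<le> real n"
      "norm (T x1 - (z + w)) < \<delta>" "norm (T x2 - (z - w)) < \<delta>"
      by (simp_all add: dist_norm)
    define x where "x = (1/2) *\<^sub>R (x1 - x2)"
    have "T x - w = (1/2) *\<^sub>R ((T x1 - (z + w)) - (T x2 - (z - w)))"
    proof -
      have eq: "(T x1 - (z + w)) - (T x2 - (z - w)) = (T x1 - T x2) - 2 *\<^sub>R w"
        by (simp add: scaleR_2)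
      show ?thesis unfolding eq by (simp add: x_def scaleR diff scaleR_right_diff_distrib)
    qed
    then have "norm (T x - w) < \<delta>"
      using norm_triangle_ineq4[of "T x1 - (z + w)" "T x2 - (z - w)"] x by simp
    moreover have "norm x \<le> real n"
      using norm_triangle_ineq4[of x1 x2] x by (simp add: x_def)
    ultimately show ?thesis by blast
  qed
  define M where "M = 2 * (real n + 1) / e"
  show thesis
  proof (rule that[of M])
    show "M > 0" using e by (simp add: M_def)
    fix y and \<delta> :: real assume \<delta>: "\<delta> > 0"
    show "\<exists>x. norm (T x - y) < \<delta> \<and> norm x \<le> M * norm y"
    proof (cases "y = 0")
      case True
      with \<delta> show ?thesis by (intro exI[of _ 0]) (simp add: zero)
    next
      case False
      define s where "s = e / (2 * norm y)"
      have s: "s > 0" using e False by (simp add: s_def)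
      have "norm (s *\<^sub>R y) < e" using e False by (simp add: s_def)
      with near[of "s *\<^sub>R y" "s * \<delta>"] s \<delta>
      obtain x where x: "norm (T x - s *\<^sub>R y) < s * \<delta>" "norm x \<le> real n" by auto
      have eq: "T ((1/s) *\<^sub>R x) - y = (1/s) *\<^sub>R (T x - s *\<^sub>R y)"
        using s by (simp add: scaleR algebra_simps)
      have "norm (T ((1/s) *\<^sub>R x) - y) < \<delta>"
        unfolding eq norm_scaleR
        using x s by (simp add: divide_less_eq mult.commute del: scaleR_right_diff_distrib)
      moreover have "norm ((1/s) *\<^sub>R x) \<le> M * norm y"
      proof -
        have "norm ((1/s) *\<^sub>R x) \<le> (1/s) * (real n + 1)"
          using x s by (simp add: field_simps)
        also have "\<dots> = M * norm y" using e False by (simp add: s_def M_def)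
        finally show ?thesis .
      qed
      ultimately show ?thesis by blast
    qed
  qed
qed

text \<open>
  An approximate preimage with error \<open>\<parallel>y\<parallel> / 2\<close> is improved by applying the same choice to the error; the
  corrections form a geometrically convergent series, so the constant only doubles.
\<close>

theorem open_mapping_bound:
  fixes T :: "'a::banach \<Rightarrow> 'b::banach"
  assumes T: "bounded_linear T" and surj: "surj T"
  shows "\<exists>C>0. \<forall>y. \<exists>x. T x = y \<and> norm x \<le> C * norm y"
proof -
  interpret bounded_linear T by fact
  obtain M where M: "M > 0"
    and approx: "\<And>y \<delta>. \<delta> > 0 \<Longrightarrow> \<exists>x. norm (T x - y) < \<delta> \<and> norm x \<le> M * norm y"
    using surj_approximate_preimage[OF T surj] by blast
  have "\<exists>x. norm (T x - y) \<le> norm y / 2 \<and> norm x \<le> M * norm y" for y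
  proof (cases "y = 0")
    case True
    then show ?thesis by (intro exI[of _ 0]) (simp add: zero)
  next
    case False
    then show ?thesis using approx[of "norm y / 2" y] by (auto intro: less_imp_le)
  qed
  then obtain g where g: "\<And>y. norm (T (g y) - y) \<le> norm y / 2" "\<And>y. norm (g y) \<le> M * norm y"
    by metis
  show ?thesis
  proof (intro exI[of _ "M * 2"] conjI allI)
    fix y
    define r where "r k = ((\<lambda>v. v - T (g v)) ^^ k) y" for k
    have r0: "r 0 = y" and rS: "r (Suc k) = r k - T (g (r k))" for k
      by (simp_all add: r_def)
    have r: "norm (r k) \<le> norm y * (1/2) ^ k" for k
    proof (induction k)
      case (Suc k)
      have "norm (r (Suc k)) \<le> norm (r k) / 2"
        using g(1)[of "r k"] by (simp add: rS norm_minus_commute)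
      with Suc show ?case by simp
    qed (simp add: r0)
    have gb: "norm (g (r k)) \<le> M * norm y * (1/2) ^ k" for k
      using order_trans[OF g(2) mult_left_mono[OF r[of k], of M]] M by (simp add: mult.assoc)
    have geo: "summable (\<lambda>k. M * norm y * (1/2) ^ k)"
      by (intro summable_mult summable_geometric) simp
    have sn: "summable (\<lambda>k. norm (g (r k)))"
      by (rule summable_comparison_test'[OF geo, of 0]) (use gb in simp)
    have sm: "summable (\<lambda>k. g (r k))" by (rule summable_norm_cancel[OF sn])
    define x where "x = (\<Sum>k. g (r k))"
    have "T x = y"
    proof (rule LIMSEQ_unique)
      have partial: "(\<Sum>k<n. T (g (r k))) = y - r n" for n
        by (induction n) (simp_all add: r0 rS)
      show "(\<lambda>n. \<Sum>k<n. T (g (r k))) \<longlonglongrightarrow> T x"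
        using sums[OF summable_sums[OF sm]] by (simp add: x_def sums_def)
      have "(\<lambda>k. norm y * (1/2) ^ k) \<longlonglongrightarrow> norm y * 0"
        by (intro tendsto_intros LIMSEQ_realpow_zero) auto
      then have "(\<lambda>k. norm y * (1/2) ^ k) \<longlonglongrightarrow> 0" by simp
      then have "(\<lambda>k. norm (r k)) \<longlonglongrightarrow> 0"
        by (rule tendsto_sandwich[OF _ _ tendsto_const, rotated 2]) (simp_all add: r)
      then have "r \<longlonglongrightarrow> 0" by (rule tendsto_norm_zero_cancel)
      then have "(\<lambda>n. y - r n) \<longlonglongrightarrow> y - 0" by (intro tendsto_diff tendsto_const)
      then show "(\<lambda>n. \<Sum>k<n. T (g (r k))) \<longlonglongrightarrow> y"
        by (simp add: partial)
    qed
    moreover have "norm x \<le> M * 2 * norm y"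
    proof -
      have "norm x \<le> (\<Sum>k. norm (g (r k)))" unfolding x_def by (rule summable_norm[OF sn])
      also have "\<dots> \<le> (\<Sum>k. M * norm y * (1/2) ^ k)" by (rule suminf_le[OF gb sn geo])
      also have "\<dots> = M * norm y * 2" by (simp add: suminf_mult suminf_geometric)
      finally show ?thesis by simp
    qed
    ultimately show "\<exists>x. T x = y \<and> norm x \<le> M * 2 * norm y" by blast
  qed (use M in simp)
qed

section \<open>Bounded operators, adjoints and direct sums\<close>

lemma cblinfun_apply_linear:
  fixes f :: "'a::complex_normed_vector \<Rightarrow>\<^bsub>CL\<^esub> 'b::complex_normed_vector"
  shows "f (x + y) = f x + f y" "f (x - y) = f x - f y" "f (- x) = - f x" "f 0 = 0"
    "f (r *\<^sub>R x) = r *\<^sub>R f x" "f (\<Sum>i\<in>I. v i) = (\<Sum>i\<in>I. f (v i))"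
proof -
  interpret bounded_linear "cblinfun_apply f" by (rule bounded_linear_cblinfun)
  show "f (x + y) = f x + f y" "f (x - y) = f x - f y" "f (- x) = - f x" "f 0 = 0"
    "f (r *\<^sub>R x) = r *\<^sub>R f x" "f (\<Sum>i\<in>I. v i) = (\<Sum>i\<in>I. f (v i))"
    by (rule add diff neg zero scaleR sum)+
qed

lemma cblinfun_sum_apply:
  fixes f :: "'i \<Rightarrow> 'a::complex_normed_vector \<Rightarrow>\<^bsub>CL\<^esub> 'b::complex_normed_vector"
  shows "cblinfun_apply (\<Sum>i\<in>I. f i) x = (\<Sum>i\<in>I. f i x)"
  by (induction I rule: infinite_finite_induct) (simp_all add: zero_cblinfun.rep_eq plus_cblinfun.rep_eq)

lemmas cblinfun_op_apply =
  zero_cblinfun.rep_eq plus_cblinfun.rep_eq minus_cblinfun.rep_eq uminus_cblinfun.rep_eq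
  scaleR_cblinfun.rep_eq scaleC_cblinfun.rep_eq cblinfun_id.rep_eq cblinfun_compose.rep_eq
  cblinfun_adjoint.rep_eq cblinfun_sum_apply

lemma cblinfun_compose_diff_left: "(f - g) o\<^sub>C h = f o\<^sub>C h - g o\<^sub>C h"
  by (rule cblinfun_eqI) (simp add: cblinfun_op_apply)

lemma cblinfun_compose_diff_right: "f o\<^sub>C (g - h) = f o\<^sub>C g - f o\<^sub>C h"
  by (rule cblinfun_eqI) (simp add: cblinfun_op_apply cblinfun_apply_linear)

lemma cblinfun_compose_scaleR:
  "(r *\<^sub>R f) o\<^sub>C h = r *\<^sub>R (f o\<^sub>C h)" "f o\<^sub>C (r *\<^sub>R h) = r *\<^sub>R (f o\<^sub>C h)"
  by (rule cblinfun_eqI, simp add: cblinfun_op_apply cblinfun_apply_linear)+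

lemma cblinfun_compose_sum_left: "(\<Sum>i\<in>I. f i) o\<^sub>C h = (\<Sum>i\<in>I. f i o\<^sub>C h)"
  by (rule cblinfun_eqI) (simp add: cblinfun_op_apply)

lemma cblinfun_compose_sum_right: "h o\<^sub>C (\<Sum>i\<in>I. f i) = (\<Sum>i\<in>I. h o\<^sub>C f i)"
  by (rule cblinfun_eqI) (simp add: cblinfun_op_apply cblinfun_apply_linear)

lemmas cblinfun_compose_algebra =
  cblinfun_compose_add_left cblinfun_compose_add_right cblinfun_compose_diff_left
  cblinfun_compose_diff_right cblinfun_compose_minus cblinfun_compose_zero cblinfun_compose_id
  cblinfun_compose_scaleR

lemma norm_compose_le: "norm f \<le> a \<Longrightarrow> norm g \<le> b \<Longrightarrow> norm (f o\<^sub>C g) \<le> a * b"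
  by (meson mult_mono norm_cblinfun_compose norm_ge_zero order_trans)

lemma adjoint_compose: "cblinfun_adjoint (f o\<^sub>C g) = cblinfun_adjoint g o\<^sub>C cblinfun_adjoint f"
  by (rule cblinfun_eqI) (simp add: cblinfun_op_apply cblinfun_compose_assoc)

lemma adjoint_diff: "cblinfun_adjoint (f - g) = cblinfun_adjoint f - cblinfun_adjoint g"
  by (rule cblinfun_eqI) (simp add: cblinfun_op_apply cblinfun_compose_algebra)

lemma adjoint_id: "cblinfun_adjoint cblinfun_id = cblinfun_id"
  by (rule cblinfun_eqI) (simp add: cblinfun_op_apply cblinfun_compose_id)

lemma norm_adjoint_le: "norm (cblinfun_adjoint f) \<le> norm f"
proof (rule norm_cblinfun_bound)
  show "norm (cblinfun_adjoint f \<phi>) \<le> norm f * norm \<phi>" for \<phi>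
    using norm_cblinfun_compose[of \<phi> f] by (simp add: cblinfun_adjoint.rep_eq mult.commute)
qed simp

text \<open>
  This is where separation of points is needed for the dual sequence: without it the spaces
  \<open>im Q\<^sub>m\<^sup>*\<close> might be trivial and their lower norms meaningless.
\<close>

lemma adjoint_eq_zero_imp:
  fixes f :: "'a::complex_normed_vector \<Rightarrow>\<^bsub>CL\<^esub> 'b::complex_normed_vector"
  assumes "cblinfun_adjoint f = 0"
  shows "f = 0"
proof (rule cblinfun_eqI, rule ccontr)
  fix x assume "f x \<noteq> (0 :: 'a \<Rightarrow>\<^bsub>CL\<^esub> 'b) x"
  then have "f x \<noteq> 0" by (simp add: zero_cblinfun.rep_eq)
  then obtain \<phi> :: "'b cdual" where "\<phi> (f x) \<noteq> 0" by (rule cdual_separates)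
  moreover have "cblinfun_apply (cblinfun_adjoint f \<phi>) x = 0"
    by (simp add: assms zero_cblinfun.rep_eq)
  ultimately show False by (simp add: cblinfun_op_apply)
qed

abbreviation (input) ms_fst :: "('a, 'b) max_sum \<Rightarrow> 'a" where "ms_fst p \<equiv> fst (max_sum_prod p)"
abbreviation (input) ms_snd :: "('a, 'b) max_sum \<Rightarrow> 'b" where "ms_snd p \<equiv> snd (max_sum_prod p)"

lemma ms_simps:
  fixes p q :: "('a::complex_normed_vector, 'b::complex_normed_vector) max_sum"
  shows "ms_fst (p + q) = ms_fst p + ms_fst q" "ms_snd (p + q) = ms_snd p + ms_snd q"
    "ms_fst (p - q) = ms_fst p - ms_fst q" "ms_snd (p - q) = ms_snd p - ms_snd q"
    "ms_fst (0 :: ('a, 'b) max_sum) = 0" "ms_snd (0 :: ('a, 'b) max_sum) = 0"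
    "ms_fst (r *\<^sub>R p) = r *\<^sub>R ms_fst p" "ms_snd (r *\<^sub>R p) = r *\<^sub>R ms_snd p"
    "ms_fst (c *\<^sub>C p) = c *\<^sub>C ms_fst p" "ms_snd (c *\<^sub>C p) = c *\<^sub>C ms_snd p"
    "max_sum_prod (Max_Sum z) = z"
  by (simp_all add: plus_max_sum.rep_eq minus_max_sum.rep_eq zero_max_sum.rep_eq Max_Sum_inverse
      scaleR_max_sum.rep_eq scaleC_max_sum.rep_eq split: prod.splits)

lemma norm_ms: "norm p = max (norm (ms_fst p)) (norm (ms_snd p))"
  by (simp add: norm_max_sum.rep_eq split: prod.splits)

lemma dsum_apply:
  "ms_fst ((f \<oplus>\<^sub>C g) p) = f (ms_fst p)" "ms_snd ((f \<oplus>\<^sub>C g) p) = g (ms_snd p)"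
  by (simp_all add: cblinfun_dsum.rep_eq ms_simps)

lemma dsum_compose: "(f \<oplus>\<^sub>C g) o\<^sub>C (h \<oplus>\<^sub>C k) = (f o\<^sub>C h) \<oplus>\<^sub>C (g o\<^sub>C k)"
  by (rule cblinfun_eqI) (simp add: max_sum_expand cblinfun_op_apply dsum_apply)

lemma dsum_diff: "(f - h) \<oplus>\<^sub>C (g - k) = (f \<oplus>\<^sub>C g) - (h \<oplus>\<^sub>C k)"
  by (rule cblinfun_eqI) (simp add: max_sum_expand cblinfun_op_apply dsum_apply ms_simps)

lemma dsum_id: "cblinfun_id \<oplus>\<^sub>C cblinfun_id = cblinfun_id"
  by (rule cblinfun_eqI) (simp add: max_sum_expand cblinfun_op_apply dsum_apply)

lemma max_norm_mult_bound:
  assumes "norm x \<le> a * norm u" "norm y \<le> b * norm v" "0 \<le> max a b"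
  shows "max (norm x) (norm y) \<le> max a b * max (norm u) (norm v)"
proof -
  have "a * norm u \<le> max a b * max (norm u) (norm v)"
    using assms(3) by (meson max.cobounded1 mult_mono norm_ge_zero)
  moreover have "b * norm v \<le> max a b * max (norm u) (norm v)"
    using assms(3) by (meson max.cobounded2 mult_mono norm_ge_zero)
  ultimately show ?thesis using assms by simp
qed

lemma norm_dsum_le: "norm (f \<oplus>\<^sub>C g) \<le> max (norm f) (norm g)"
proof (rule norm_cblinfun_bound)
  show "norm ((f \<oplus>\<^sub>C g) p) \<le> max (norm f) (norm g) * norm p" for p
    unfolding norm_ms[of p] norm_ms[of "cblinfun_apply (f \<oplus>\<^sub>C g) p"] dsum_apply
    by (rule max_norm_mult_bound) (auto intro: norm_cblinfun simp: le_max_iff_disj)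
qed (simp add: le_max_iff_disj)

text \<open>
  The operator matrix on the direct sum with zero diagonal and off-diagonal entries \<open>E\<close> and \<open>G\<close>.
\<close>

lift_definition cblinfun_offdiag ::
  "('b::complex_normed_vector \<Rightarrow>\<^bsub>CL\<^esub> 'c::complex_normed_vector) \<Rightarrow>
    ('a::complex_normed_vector \<Rightarrow>\<^bsub>CL\<^esub> 'd::complex_normed_vector) \<Rightarrow>
    ('a, 'b) max_sum \<Rightarrow>\<^bsub>CL\<^esub> ('c, 'd) max_sum"
  is "\<lambda>E G p. Max_Sum (E (snd (max_sum_prod p)), G (fst (max_sum_prod p)))"
proof (intro conjI allI)
  fix E :: "'b \<Rightarrow> 'c" and G :: "'a \<Rightarrow> 'd"
  let ?T = "\<lambda>p. Max_Sum (E (snd (max_sum_prod p)), G (fst (max_sum_prod p)))"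
  assume E: "bounded_linear E \<and> (\<forall>c x. E (c *\<^sub>C x) = c *\<^sub>C E x)"
    and G: "bounded_linear G \<and> (\<forall>c x. G (c *\<^sub>C x) = c *\<^sub>C G x)"
  interpret E: bounded_linear E using E by simp
  interpret G: bounded_linear G using G by simp
  obtain a b where ab: "\<And>x. norm (E x) \<le> norm x * a" "\<And>x. norm (G x) \<le> norm x * b" "0 < a" "0 < b"
    using E.pos_bounded G.pos_bounded by metis
  show "bounded_linear ?T"
  proof (rule bounded_linear_intro[where K = "max a b"])
    fix p q :: "('a, 'b) max_sum" and r :: real
    show "?T (p + q) = ?T p + ?T q"
      by (simp add: max_sum_expand ms_simps E.add G.add)
    show "?T (r *\<^sub>R p) = r *\<^sub>R ?T p"
      by (simp add: max_sum_expand ms_simps E.scaleR G.scaleR)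
    have "norm (?T p) \<le> max a b * max (norm (ms_snd p)) (norm (ms_fst p))"
      unfolding norm_ms[of "?T p"] ms_simps fst_conv snd_conv
      by (rule max_norm_mult_bound) (use ab in \<open>simp_all add: mult.commute le_max_iff_disj\<close>)
    then show "norm (?T p) \<le> norm p * max a b"
      by (simp add: norm_ms[of p] mult.commute max.commute)
  qed
  show "?T (c *\<^sub>C p) = c *\<^sub>C ?T p" for c p
    using E G by (simp add: max_sum_expand ms_simps)
qed

lemma offdiag_apply:
  "ms_fst (cblinfun_offdiag E G p) = E (ms_snd p)" "ms_snd (cblinfun_offdiag E G p) = G (ms_fst p)"
  by (simp_all add: cblinfun_offdiag.rep_eq ms_simps)

lemma dsum_offdiag_compose:
  "(f \<oplus>\<^sub>C g) o\<^sub>C cblinfun_offdiag E G = cblinfun_offdiag (f o\<^sub>C E) (g o\<^sub>C G)"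
  "cblinfun_offdiag E G o\<^sub>C (f \<oplus>\<^sub>C g) = cblinfun_offdiag (E o\<^sub>C g) (G o\<^sub>C f)"
  by (rule cblinfun_eqI, simp add: max_sum_expand cblinfun_op_apply dsum_apply offdiag_apply)+

lemma norm_offdiag_le: "norm (cblinfun_offdiag E G) \<le> max (norm E) (norm G)"
proof (rule norm_cblinfun_bound)
  fix p
  have "norm (cblinfun_offdiag E G p) \<le> max (norm E) (norm G) * max (norm (ms_snd p)) (norm (ms_fst p))"
    unfolding norm_ms[of "cblinfun_apply (cblinfun_offdiag E G) p"] offdiag_apply
    by (rule max_norm_mult_bound) (auto intro: norm_cblinfun simp: le_max_iff_disj)
  then show "norm (cblinfun_offdiag E G p) \<le> max (norm E) (norm G) * norm p"
    by (simp add: norm_ms[of p] max.commute)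
qed (simp add: le_max_iff_disj)

lift_definition rank_one ::
  "'b::complex_normed_vector \<Rightarrow> 'a::complex_normed_vector cdual \<Rightarrow> 'a \<Rightarrow>\<^bsub>CL\<^esub> 'b"
  is "\<lambda>v \<phi> x. \<phi> x *\<^sub>C v"
proof (intro conjI allI)
  fix v :: 'b and \<phi> :: "'a \<Rightarrow> complex"
  assume \<phi>: "bounded_linear \<phi> \<and> (\<forall>c x. \<phi> (c *\<^sub>C x) = c *\<^sub>C \<phi> x)"
  interpret bounded_linear \<phi> using \<phi> by simp
  obtain K where K: "\<And>x. norm (\<phi> x) \<le> norm x * K" using bounded by blast
  show "bounded_linear (\<lambda>x. \<phi> x *\<^sub>C v)"
  proof (rule bounded_linear_intro[where K = "K * norm v"])
    show "norm (\<phi> x *\<^sub>C v) \<le> norm x * (K * norm v)" for x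
      using mult_right_mono[OF K[of x], of "norm v"] by (simp add: norm_scaleC mult.assoc)
    show "\<phi> (x + y) *\<^sub>C v = \<phi> x *\<^sub>C v + \<phi> y *\<^sub>C v" for x y
      by (simp add: add scaleC_add_left)
    show "\<phi> (r *\<^sub>R x) *\<^sub>C v = r *\<^sub>R \<phi> x *\<^sub>C v" for r x
      unfolding scaleR by (simp add: scaleR_scaleC scaleC_scaleC scaleC_complex_def)
  qed
  show "\<phi> (c *\<^sub>C x) *\<^sub>C v = c *\<^sub>C \<phi> x *\<^sub>C v" for c x
    using \<phi> by (simp add: scaleC_complex_def scaleC_scaleC)
qed

lemma compose_rank_one: "T o\<^sub>C rank_one v \<phi> = rank_one (T v) \<phi>"
  by (rule cblinfun_eqI) (simp add: cblinfun_op_apply rank_one.rep_eq cblinfun_scaleC)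

lemma rank_one_compose: "rank_one v \<phi> o\<^sub>C T = rank_one v (\<phi> o\<^sub>C T)"
  by (rule cblinfun_eqI) (simp add: cblinfun_op_apply rank_one.rep_eq)

lemma norm_rank_one_le: "norm (rank_one v \<phi>) \<le> norm v * norm \<phi>"
proof (rule norm_cblinfun_bound)
  show "norm (rank_one v \<phi> x) \<le> norm v * norm \<phi> * norm x" for x
    using mult_left_mono[OF norm_cblinfun[of \<phi> x], of "norm v"]
    by (simp add: rank_one.rep_eq norm_scaleC ac_simps)
qed simp

lift_definition evaluation :: "'a::complex_normed_vector \<Rightarrow> 'a cdual cdual" is "\<lambda>x \<phi>. cblinfun_apply \<phi> x"
proof (intro conjI allI)
  fix x :: 'a
  show "bounded_linear (\<lambda>\<phi> :: 'a cdual. cblinfun_apply \<phi> x)"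
    by (rule bounded_linear_intro[where K = "norm x"]) (simp_all add: cblinfun_op_apply norm_cblinfun)
qed (simp add: cblinfun_op_apply)

lemma norm_evaluation_le: "norm (evaluation x) \<le> norm x"
  by (rule norm_cblinfun_bound) (use norm_cblinfun in \<open>auto simp: evaluation.rep_eq mult.commute\<close>)

lemma evaluation_adjoint: "evaluation x o\<^sub>C cblinfun_adjoint T = evaluation (T x)"
  by (rule cblinfun_eqI) (simp add: cblinfun_op_apply evaluation.rep_eq)

section \<open>Nested sequences of contractive projections\<close>

text \<open>
  Contractivity and \<open>Q\<^sub>n \<noteq> 0\<close> replace norms equal to one, because in this form the conditions pass to the
  adjoint sequence and to direct sums by separation of points alone.
\<close>

locale nested_projections =
  fixes P :: "nat \<Rightarrow> 'a::complex_banach endo"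
  assumes idem: "P n o\<^sub>C P n = P n"
    and Suc_left: "P n o\<^sub>C P (Suc n) = P n"
    and Suc_right: "P (Suc n) o\<^sub>C P n = P n"
    and norm_P: "norm (P n) \<le> 1"
    and norm_Q: "norm (cproj P n) \<le> 1"
    and Q_nonzero: "cproj P n \<noteq> 0"
begin

abbreviation Q :: "nat \<Rightarrow> 'a endo" where "Q \<equiv> cproj P"

lemma P_add_Q: "P n + Q n = cblinfun_id"
  by (simp add: cproj_def)

lemma P_absorb: "m \<le> n \<Longrightarrow> P m o\<^sub>C P n = P m \<and> P n o\<^sub>C P m = P m"
proof (induction n rule: dec_induct)
  case (step n)
  have "P m o\<^sub>C P (Suc n) = P m o\<^sub>C (P n o\<^sub>C P (Suc n))"
    using step.IH by (simp flip: cblinfun_compose_assoc)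
  moreover have "P (Suc n) o\<^sub>C P m = (P (Suc n) o\<^sub>C P n) o\<^sub>C P m"
    using step.IH by (simp add: cblinfun_compose_assoc)
  ultimately show ?case using step.IH by (simp add: Suc_left Suc_right)
qed (simp add: idem)

lemma Q_P_zero: "m \<le> n \<Longrightarrow> Q n o\<^sub>C P m = 0" "m \<le> n \<Longrightarrow> P m o\<^sub>C Q n = 0"
  by (simp_all add: cproj_def cblinfun_compose_algebra P_absorb)

lemma Q_absorb: "m \<le> n \<Longrightarrow> Q m o\<^sub>C Q n = Q n"
  by (simp add: cproj_def cblinfun_compose_algebra P_absorb)

lemma Q_apply_range: "x \<in> range (Q m) \<Longrightarrow> Q m x = x"
  using Q_absorb[of m m] by (metis cblinfun_compose.rep_eq imageE order_refl)

lemma range_Q_antimono: "m \<le> n \<Longrightarrow> range (Q n) \<subseteq> range (Q m)"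
  by (metis (no_types, lifting) Q_absorb cblinfun_compose.rep_eq image_subset_iff rangeI)

lemma P_Pcompact: "P m \<in> Pcompact P"
proof -
  have "\<forall>\<^sub>F n in sequentially. norm (Q n o\<^sub>C P m) + norm (P m o\<^sub>C Q n) = 0"
    using eventually_ge_at_top[of m] by eventually_elim (simp add: Q_P_zero)
  then show ?thesis by (auto simp: Pcompact_def intro: tendsto_eventually)
qed

lemma exists_unit_range_Q: "\<exists>x\<in>range (Q m). norm x = 1"
proof -
  obtain x where "Q m x \<noteq> 0"
    using Q_nonzero[of m] cblinfun_eqI[of "Q m" 0] by (auto simp: zero_cblinfun.rep_eq)
  then have "norm (Q m ((1 / norm (Q m x)) *\<^sub>R x)) = 1"
    by (simp add: cblinfun_apply_linear)
  then show ?thesis by blast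
qed

end

lemma Pcompact_scaleR: "K \<in> Pcompact P \<Longrightarrow> r *\<^sub>R K \<in> Pcompact P"
  by (auto simp: Pcompact_iff cblinfun_compose_scaleR intro: tendsto_mult_right_zero)

lemma Pcompact_diff: "K \<in> Pcompact P \<Longrightarrow> L \<in> Pcompact P \<Longrightarrow> K - L \<in> Pcompact P"
  using Pcompact_add[OF _ Pcompact_uminus, of K P L] by simp

lemma uniform_approx_proj_nested:
  assumes "uniform_approx_proj P"
  shows "nested_projections P"
proof
  fix n
  show "P n o\<^sub>C P n = P n" "norm (P n) \<le> 1" "norm (cproj P n) \<le> 1"
    using assms by (simp_all add: uniform_approx_proj_def)
  show "P n o\<^sub>C P (Suc n) = P n" "P (Suc n) o\<^sub>C P n = P n"
    using assms unfolding uniform_approx_proj_def by metis+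
  have "norm (cproj P n) = 1"
    using assms by (simp add: uniform_approx_proj_def)
  then show "cproj P n \<noteq> 0" by auto
qed

lemma cproj_adjoint_seq: "cproj (adjoint_seq P) n = cblinfun_adjoint (cproj P n)"
  by (simp add: cproj_def adjoint_seq_def adjoint_diff adjoint_id)

lemma cproj_dsum_seq: "cproj (dsum_seq P R) n = cproj P n \<oplus>\<^sub>C cproj R n"
  by (simp add: cproj_def dsum_seq_def dsum_diff dsum_id)

lemma nested_projections_adjoint:
  assumes "nested_projections P"
  shows "nested_projections (adjoint_seq P)"
proof -
  interpret nested_projections P by fact
  show ?thesis
  proof
    fix n
    show "adjoint_seq P n o\<^sub>C adjoint_seq P n = adjoint_seq P n"
      "adjoint_seq P n o\<^sub>C adjoint_seq P (Suc n) = adjoint_seq P n"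
      "adjoint_seq P (Suc n) o\<^sub>C adjoint_seq P n = adjoint_seq P n"
      by (simp_all add: adjoint_seq_def idem Suc_left Suc_right flip: adjoint_compose)
    show "norm (adjoint_seq P n) \<le> 1" "norm (cproj (adjoint_seq P) n) \<le> 1"
      unfolding cproj_adjoint_seq unfolding adjoint_seq_def
      by (rule order_trans[OF norm_adjoint_le], rule norm_P norm_Q)+
    show "cproj (adjoint_seq P) n \<noteq> 0"
      unfolding cproj_adjoint_seq using adjoint_eq_zero_imp Q_nonzero by blast
  qed
qed

lemma nested_projections_dsum:
  assumes "nested_projections P" "nested_projections R"
  shows "nested_projections (dsum_seq P R)"
proof -
  interpret P: nested_projections P by fact
  interpret R: nested_projections R by fact
  show ?thesis
  proof
    fix n
    show "dsum_seq P R n o\<^sub>C dsum_seq P R n = dsum_seq P R n"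
      "dsum_seq P R n o\<^sub>C dsum_seq P R (Suc n) = dsum_seq P R n"
      "dsum_seq P R (Suc n) o\<^sub>C dsum_seq P R n = dsum_seq P R n"
      by (simp_all add: dsum_seq_def dsum_compose P.idem P.Suc_left P.Suc_right
          R.idem R.Suc_left R.Suc_right)
    show "norm (dsum_seq P R n) \<le> 1"
      unfolding dsum_seq_def using norm_dsum_le[of "P n" "R n"] P.norm_P[of n] R.norm_P[of n] by simp
    show "norm (cproj (dsum_seq P R) n) \<le> 1"
      unfolding cproj_dsum_seq
      using norm_dsum_le[of "cproj P n" "cproj R n"] P.norm_Q[of n] R.norm_Q[of n] by simp
    obtain x where x: "cproj P n x = x" "norm x = 1"
      using P.exists_unit_range_Q[of n] P.Q_apply_range by blast
    have "ms_fst (cproj (dsum_seq P R) n (Max_Sum (x, 0))) \<noteq> 0"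
      using x by (auto simp: cproj_dsum_seq dsum_apply ms_simps)
    then show "cproj (dsum_seq P R) n \<noteq> 0"
      by (auto simp: zero_cblinfun.rep_eq ms_simps)
  qed
qed

section \<open>Lower norms along a sequence of projections\<close>

lemma lower_norm_on_le: "x \<in> S \<Longrightarrow> norm x = 1 \<Longrightarrow> lower_norm_on S B \<le> norm (cblinfun_apply B x)"
  unfolding lower_norm_on_def by (rule cINF_lower) (auto intro: bdd_belowI2[where m = 0])

lemma lower_norm_on_greatest:
  "\<exists>x\<in>S. norm x = 1 \<Longrightarrow> (\<And>x. x \<in> S \<Longrightarrow> norm x = 1 \<Longrightarrow> b \<le> norm (cblinfun_apply B x)) \<Longrightarrow> b \<le> lower_norm_on S B"
  unfolding lower_norm_on_def by (rule cINF_greatest) auto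

lemma lower_norm_range_mult_le:
  assumes "x \<in> range (cblinfun_apply T)"
  shows "lower_norm_on (range (cblinfun_apply T)) B * norm x \<le> norm (cblinfun_apply B x)"
proof (cases "x = 0")
  case False
  obtain z where z: "x = T z" using assms by blast
  have "lower_norm_on (range (cblinfun_apply T)) B \<le> norm (cblinfun_apply B ((1 / norm x) *\<^sub>R x))"
  proof (rule lower_norm_on_le)
    have "(1 / norm x) *\<^sub>R x = T ((1 / norm x) *\<^sub>R z)"
      by (simp add: z cblinfun_apply_linear)
    then show "(1 / norm x) *\<^sub>R x \<in> range (cblinfun_apply T)" by blast
  qed (use False in simp)
  also have "\<dots> = norm (B x) / norm x"
    by (simp add: cblinfun_apply_linear)
  finally show ?thesis using False by (simp add: field_simps)
qed simp

context nested_projections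
begin

abbreviation lower_Q :: "nat \<Rightarrow> ('a \<Rightarrow>\<^bsub>CL\<^esub> 'b::complex_normed_vector) \<Rightarrow> real"
  where "lower_Q m D \<equiv> lower_norm_on (range (Q m)) D"

lemma lower_Q_mono: "m \<le> n \<Longrightarrow> lower_Q m D \<le> lower_Q n D"
  using exists_unit_range_Q[of n] range_Q_antimono[of m n]
  by (intro lower_norm_on_greatest) (auto intro!: lower_norm_on_le)

lemma lower_Q_tendsto: "(\<lambda>m. lower_Q m D) \<longlonglongrightarrow> mu_tilde P D"
proof -
  have "lower_Q m D \<le> norm D" for m
  proof -
    obtain x where "x \<in> range (Q m)" "norm x = 1" using exists_unit_range_Q by blast
    then show ?thesis
      using lower_norm_on_le[of x "range (Q m)" D] norm_cblinfun[of D x] by simp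
  qed
  moreover have "incseq (\<lambda>m. lower_Q m D)"
    by (intro incseq_SucI lower_Q_mono) simp
  ultimately obtain l where "(\<lambda>m. lower_Q m D) \<longlonglongrightarrow> l"
    using incseq_convergent[of "\<lambda>m. lower_Q m D" "norm D"] by blast
  then show ?thesis by (simp add: mu_tilde_def limI)
qed

text \<open>
  On \<open>im Q\<^sub>m\<close> the operator \<open>K\<close> acts as \<open>K Q\<^sub>m\<close>, whose norm tends to zero.
\<close>

lemma lower_norm_perturbed_le:
  assumes "K \<in> Pcompact P"
  shows "lower_norm_on UNIV (D + K) \<le> mu_tilde P D"
proof (rule LIMSEQ_le_const[where X = "\<lambda>m. lower_Q m D + norm (K o\<^sub>C Q m)"])
  show "(\<lambda>m. lower_Q m D + norm (K o\<^sub>C Q m)) \<longlonglongrightarrow> mu_tilde P D"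
    using tendsto_add[OF lower_Q_tendsto, of "\<lambda>m. norm (K o\<^sub>C Q m)" 0] assms
    by (simp add: Pcompact_iff)
  have "lower_norm_on UNIV (D + K) - norm (K o\<^sub>C Q m) \<le> lower_Q m D" for m
  proof (rule lower_norm_on_greatest[OF exists_unit_range_Q])
    fix x assume x: "x \<in> range (Q m)" "norm x = 1"
    have "lower_norm_on UNIV (D + K) \<le> norm ((D + K) x)"
      by (rule lower_norm_on_le) (use x in auto)
    also have "(D + K) x = D x + (K o\<^sub>C Q m) x"
      by (simp add: cblinfun_op_apply Q_apply_range[OF x(1)])
    also have "norm \<dots> \<le> norm (D x) + norm (K o\<^sub>C Q m)"
      using norm_triangle_ineq[of "D x" "(K o\<^sub>C Q m) x"] norm_cblinfun[of "K o\<^sub>C Q m" x] x by simp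
    finally show "lower_norm_on UNIV (D + K) - norm (K o\<^sub>C Q m) \<le> norm (D x)" by simp
  qed
  then show "\<exists>N. \<forall>m\<ge>N. lower_norm_on UNIV (D + K) \<le> lower_Q m D + norm (K o\<^sub>C Q m)"
    by (simp add: diff_le_eq)
qed

lemma nu_ess_le_mu_tilde: "nu_ess P D \<le> mu_tilde P D"
  unfolding nu_ess_def
  by (rule cSUP_least) (use Pcompact_zero lower_norm_perturbed_le in auto)

lemma lower_norm_perturbed_le_nu_ess:
  "K \<in> Pcompact P \<Longrightarrow> lower_norm_on UNIV (D + K) \<le> nu_ess P D"
  unfolding nu_ess_def
  by (rule cSUP_upper) (auto intro: bdd_aboveI2[where M = "mu_tilde P D"] lower_norm_perturbed_le)

text \<open>
  A crude lower bound for one perturbation, together with a left regularizer \<open>C\<close> of small norm, yields a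
  sharp bound for another perturbation, namely \<open>(D + K) (Q\<^sub>n + t P\<^sub>n)\<close>. With \<open>y = (Q\<^sub>n + t P\<^sub>n) x\<close> one
  recovers \<open>x = Q\<^sub>n y + t\<^sup>-\<^sup>1 P\<^sub>n y\<close>. The second term is small by the crude bound if \<open>t\<close> is large, and
  \<open>Q\<^sub>n y\<close> agrees with \<open>Q\<^sub>n C (D + K) y\<close> up to an error that tends to zero with growing \<open>n\<close>.
\<close>

theorem nu_ess_ge:
  assumes K: "K \<in> Pcompact P"
    and c: "\<And>y. norm y \<le> c * norm ((D + K) y)"
    and DP: "\<And>n. D o\<^sub>C P n \<in> Pcompact P"
    and C: "(\<lambda>n. norm (Q n o\<^sub>C (C o\<^sub>C (D + K) - cblinfun_id))) \<longlonglongrightarrow> 0"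
    and r: "norm C \<le> r" "r > 0"
  shows "inverse r \<le> nu_ess P D"
proof -
  let ?B = "D + K"
  obtain u :: 'a where u: "norm u = 1" using exists_unit_range_Q by blast
  have "c > 0"
  proof (rule ccontr)
    assume "\<not> c > 0"
    then have "c * norm (?B u) \<le> 0" by (intro mult_nonpos_nonneg) auto
    with c[of u] u show False by simp
  qed
  define e where "e n = norm (Q n o\<^sub>C (C o\<^sub>C ?B - cblinfun_id))" for n
  \<comment> \<open>The three terms bound \<open>C\<close>, the error of the regularizer on \<open>im Q\<^sub>n\<close>, and the part of \<open>x\<close> in \<open>im P\<^sub>n\<close>.\<close>
  define s where "s n = r + c * e n + c / real (Suc n)" for n
  have s_pos: "s n > 0" for n
    using \<open>c > 0\<close> r(2) by (simp add: s_def e_def add_pos_nonneg)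
  have bound: "inverse (s n) \<le> nu_ess P D" for n
  proof -
    \<comment> \<open>One parameter suffices: \<open>t = n + 1\<close> tends to infinity together with \<open>n\<close>.\<close>
    define t where "t = real (Suc n)"
    have t: "t > 0" by (simp add: t_def)
    define G where "G = Q n + t *\<^sub>R P n"
    have "?B o\<^sub>C G = D + (K + (t - 1) *\<^sub>R (?B o\<^sub>C P n))"
      by (simp add: G_def cproj_def cblinfun_compose_algebra algebra_simps)
    moreover have "K + (t - 1) *\<^sub>R (?B o\<^sub>C P n) \<in> Pcompact P"
      using K DP[of n] P_Pcompact[of n]
      by (auto simp: cblinfun_compose_add_left intro!: Pcompact_add Pcompact_scaleR Pcompact_compose)
    ultimately have "lower_norm_on UNIV (?B o\<^sub>C G) \<le> nu_ess P D"
      using lower_norm_perturbed_le_nu_ess by metis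
    moreover have "inverse (s n) \<le> lower_norm_on UNIV (?B o\<^sub>C G)"
    proof (rule lower_norm_on_greatest)
      fix x :: 'a assume x: "norm x = 1"
      define y where "y = G x"
      have QG: "Q n o\<^sub>C G = Q n" and PG: "P n o\<^sub>C G = t *\<^sub>R P n"
        by (simp_all add: G_def cblinfun_compose_algebra Q_absorb Q_P_zero idem)
      have Qy: "Q n y = Q n x" and Py: "P n y = t *\<^sub>R P n x"
        using arg_cong[OF QG, of "\<lambda>f. cblinfun_apply f x"] arg_cong[OF PG, of "\<lambda>f. cblinfun_apply f x"]
        by (simp_all add: y_def cblinfun_op_apply)
      have "x = Q n y + (1 / t) *\<^sub>R P n y"
        using arg_cong[OF P_add_Q[of n], of "\<lambda>f. cblinfun_apply f x"] t
        by (simp add: Qy Py cblinfun_op_apply add.commute)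
      then have "norm x \<le> norm (Q n y) + norm ((1 / t) *\<^sub>R P n y)"
        using norm_triangle_ineq by metis
      then have 1: "norm x \<le> norm (Q n y) + (1 / t) * norm (P n y)"
        using t by simp
      have "norm (P n y) \<le> 1 * norm y"
        using norm_cblinfun[of "P n" y] norm_P[of n] by (meson mult_right_mono norm_ge_zero order_trans)
      then have 2: "norm (P n y) \<le> c * norm (?B y)" using c[of y] by simp
      have "Q n y = Q n (C (?B y)) - (Q n o\<^sub>C (C o\<^sub>C ?B - cblinfun_id)) y"
        by (simp add: cblinfun_op_apply cblinfun_apply_linear)
      then have "norm (Q n y) \<le> norm (Q n (C (?B y))) + norm ((Q n o\<^sub>C (C o\<^sub>C ?B - cblinfun_id)) y)"
        by (metis norm_triangle_ineq4)
      also have "norm (Q n (C (?B y))) \<le> norm (C (?B y))"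
        using norm_cblinfun[of "Q n" "C (?B y)"] norm_Q[of n]
        by (meson mult_left_le_one_le norm_ge_zero order_trans)
      also have "norm (C (?B y)) \<le> r * norm (?B y)"
        using norm_cblinfun[of C "?B y"] r by (meson mult_right_mono norm_ge_zero order_trans)
      also have "norm ((Q n o\<^sub>C (C o\<^sub>C ?B - cblinfun_id)) y) \<le> e n * norm y"
        unfolding e_def by (rule norm_cblinfun)
      also have "e n * norm y \<le> e n * (c * norm (?B y))"
        by (rule mult_left_mono[OF c]) (simp add: e_def)
      finally have 3: "norm (Q n y) \<le> r * norm (?B y) + e n * (c * norm (?B y))" by simp
      have "1 \<le> s n * norm (?B y)"
        using 1 3 mult_left_mono[OF 2, of "1 / t"] t x by (simp add: s_def t_def algebra_simps)
      then show "inverse (s n) \<le> norm ((?B o\<^sub>C G) x)"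
        using s_pos[of n] by (simp add: y_def cblinfun_op_apply field_simps)
    qed (use u in auto)
    ultimately show ?thesis by simp
  qed
  have "s \<longlonglongrightarrow> r + c * 0 + 0"
    unfolding s_def
    using C LIMSEQ_Suc[OF lim_const_over_n[of c]] by (intro tendsto_add tendsto_mult tendsto_const) (simp_all add: e_def)
  then have "(\<lambda>n. inverse (s n)) \<longlonglongrightarrow> inverse r"
    using r(2) by (intro tendsto_inverse) auto
  then show ?thesis
    by (rule LIMSEQ_le_const2) (use bound in auto)
qed

end

text \<open>
  A unit vector of the direct sum has a component of norm one, and unit vectors of the summands embed
  isometrically.
\<close>

lemma mu_tilde_dsum:
  assumes "nested_projections P" "nested_projections R"
  shows "mu_tilde (dsum_seq P R) (A \<oplus>\<^sub>C B) = min (mu_tilde P A) (mu_tilde R B)"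
proof -
  interpret P: nested_projections P by fact
  interpret R: nested_projections R by fact
  interpret PR: nested_projections "dsum_seq P R" by (rule nested_projections_dsum) fact+
  have eq: "PR.lower_Q m (A \<oplus>\<^sub>C B) = min (P.lower_Q m A) (R.lower_Q m B)" for m
  proof (rule antisym)
    have le_A: "PR.lower_Q m (A \<oplus>\<^sub>C B) \<le> norm (A x)" if x: "x \<in> range (P.Q m)" "norm x = 1" for x
    proof -
      let ?p = "Max_Sum (x, 0)"
      have "PR.Q m ?p = ?p"
        using P.Q_apply_range[OF x(1)]
        by (simp add: cproj_dsum_seq max_sum_expand dsum_apply ms_simps cblinfun_apply_linear)
      then have "PR.lower_Q m (A \<oplus>\<^sub>C B) \<le> norm ((A \<oplus>\<^sub>C B) ?p)"
        by (intro lower_norm_on_le) (metis rangeI, simp add: norm_ms ms_simps x)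
      then show ?thesis by (simp add: norm_ms dsum_apply ms_simps cblinfun_apply_linear)
    qed
    have le_B: "PR.lower_Q m (A \<oplus>\<^sub>C B) \<le> norm (B x)" if x: "x \<in> range (R.Q m)" "norm x = 1" for x
    proof -
      let ?p = "Max_Sum (0, x)"
      have "PR.Q m ?p = ?p"
        using R.Q_apply_range[OF x(1)]
        by (simp add: cproj_dsum_seq max_sum_expand dsum_apply ms_simps cblinfun_apply_linear)
      then have "PR.lower_Q m (A \<oplus>\<^sub>C B) \<le> norm ((A \<oplus>\<^sub>C B) ?p)"
        by (intro lower_norm_on_le) (metis rangeI, simp add: norm_ms ms_simps x)
      then show ?thesis by (simp add: norm_ms dsum_apply ms_simps cblinfun_apply_linear)
    qed
    show "PR.lower_Q m (A \<oplus>\<^sub>C B) \<le> min (P.lower_Q m A) (R.lower_Q m B)"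
      using le_A le_B
      by (intro min.boundedI lower_norm_on_greatest P.exists_unit_range_Q R.exists_unit_range_Q)
    show "min (P.lower_Q m A) (R.lower_Q m B) \<le> PR.lower_Q m (A \<oplus>\<^sub>C B)"
    proof (rule lower_norm_on_greatest[OF PR.exists_unit_range_Q])
      fix p assume p: "p \<in> range (PR.Q m)" "norm p = 1"
      then have range: "ms_fst p \<in> range (P.Q m)" "ms_snd p \<in> range (R.Q m)"
        by (auto simp: cproj_dsum_seq dsum_apply)
      have "norm (ms_fst p) = 1 \<or> norm (ms_snd p) = 1"
        using p(2) by (auto simp: norm_ms max_def split: if_splits)
      then show "min (P.lower_Q m A) (R.lower_Q m B) \<le> norm ((A \<oplus>\<^sub>C B) p)"
        using lower_norm_on_le[OF range(1), of A] lower_norm_on_le[OF range(2), of B]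
        by (auto simp: norm_ms[of "cblinfun_apply (A \<oplus>\<^sub>C B) p"] dsum_apply min_le_iff_disj le_max_iff_disj)
    qed
  qed
  have "(\<lambda>m. PR.lower_Q m (A \<oplus>\<^sub>C B)) \<longlonglongrightarrow> min (mu_tilde P A) (mu_tilde R B)"
    unfolding eq by (intro tendsto_min P.lower_Q_tendsto R.lower_Q_tendsto)
  then show ?thesis using PR.lower_Q_tendsto LIMSEQ_unique by blast
qed

section \<open>Off-diagonal perturbations of operators with finite-dimensional kernel and cokernel\<close>

instance bcontfun :: (metric_space, banach) banach ..

text \<open>
  The open mapping theorem for the surjection \<open>(x, c) \<mapsto> A x + \<Sum> c\<^sub>s s\<close>. The coefficients live in the
  Banach space of bounded functions on a discrete copy of the codomain, where evaluations are
  contractions, so that no space of the size of \<open>S\<close> has to be constructed.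
\<close>

lemma cofinite_range_bound:
  fixes A :: "'a::complex_banach \<Rightarrow>\<^bsub>CL\<^esub> 'b::complex_banach"
  assumes S: "finite S" and span: "complex_vector.span (range A \<union> S) = UNIV"
  obtains C where "C > 0" "\<And>y. \<exists>x c. y = A x + (\<Sum>s\<in>S. c s *\<^sub>C s) \<and> norm x \<le> C * norm y \<and>
    (\<forall>s\<in>S. cmod (c s) \<le> C * norm y)"
proof -
  interpret A: bounded_linear "cblinfun_apply A" by (rule bounded_linear_cblinfun)
  define T :: "'a \<times> ('b discrete \<Rightarrow>\<^sub>C complex) \<Rightarrow> 'b"
    where "T z = A (fst z) + (\<Sum>s\<in>S. apply_bcontfun (snd z) (discrete s) *\<^sub>C s)" for z
  have "bounded_linear (\<lambda>z :: 'a \<times> ('b discrete \<Rightarrow>\<^sub>C complex). apply_bcontfun (snd z) (discrete s) *\<^sub>C s)" for s :: 'b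
  proof (rule bounded_linear_intro[where K = "norm s"])
    fix z w :: "'a \<times> ('b discrete \<Rightarrow>\<^sub>C complex)" and r :: real
    show "apply_bcontfun (snd (z + w)) (discrete s) *\<^sub>C s
        = apply_bcontfun (snd z) (discrete s) *\<^sub>C s + apply_bcontfun (snd w) (discrete s) *\<^sub>C s"
      by (simp add: scaleC_add_left)
    show "apply_bcontfun (snd (r *\<^sub>R z)) (discrete s) *\<^sub>C s = r *\<^sub>R apply_bcontfun (snd z) (discrete s) *\<^sub>C s"
      by (simp add: scaleR_scaleC scaleC_scaleC scaleC_complex_def)
    have "cmod (apply_bcontfun (snd z) (discrete s)) \<le> norm z"
      by (rule order_trans[OF norm_bounded]) (metis norm_snd_le prod.collapse)
    then show "norm (apply_bcontfun (snd z) (discrete s) *\<^sub>C s) \<le> norm z * norm s"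
      by (simp add: norm_scaleC mult_right_mono)
  qed
  then have "bounded_linear T"
    unfolding T_def
    by (intro bounded_linear_add bounded_linear_sum bounded_linear_compose[OF A.bounded_linear]
        bounded_linear_fst)
  moreover have "surj T"
  proof -
    have "y \<in> range T" for y
    proof -
      have "y \<in> complex_vector.span (range A \<union> S)" unfolding span ..
      then obtain a b where ab: "y = a + b" "a \<in> complex_vector.span (range A)"
        "b \<in> complex_vector.span S"
        unfolding complex_vector.span_Un by blast
      have "complex_vector.subspace (range A)"
      proof (rule complex_vector.subspaceI)
        show "0 \<in> range A" using A.zero by (metis rangeI)
        show "u + v \<in> range A" if "u \<in> range A" "v \<in> range A" for u v
          using that by (auto simp flip: A.add)
        show "c *\<^sub>C u \<in> range A" if "u \<in> range A" for c u
          using that by (auto simp flip: cblinfun_scaleC)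
      qed
      then have "a \<in> range A"
        using ab(2) complex_vector.span_minimal[OF order_refl] by blast
      then obtain x where x: "a = A x" by blast
      obtain c where c: "b = (\<Sum>s\<in>S. c s *\<^sub>C s)"
        using ab S by (auto simp: complex_vector.span_finite)
      define \<psi> where "\<psi> k = (if of_discrete k \<in> S then c (of_discrete k) else 0)" for k
      have "\<psi> \<in> bcontfun"
      proof (rule bcontfun_normI)
        show "norm (\<psi> k) \<le> (\<Sum>s\<in>S. cmod (c s))" for k
          using S by (auto simp: \<psi>_def sum_nonneg intro: member_le_sum)
        show "continuous_on UNIV \<psi>"
          by (simp add: continuous_on_open_vimage open_discrete)
      qed
      then obtain \<phi> where \<phi>: "\<psi> = apply_bcontfun \<phi>" by (rule bcontfunE)
      have "(\<Sum>s\<in>S. apply_bcontfun \<phi> (discrete s) *\<^sub>C s) = b"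
        unfolding c \<phi>[symmetric] by (intro sum.cong) (auto simp: \<psi>_def discrete_inverse)
      then have "T (x, \<phi>) = y" by (simp add: T_def ab x)
      then show ?thesis by blast
    qed
    then show ?thesis by blast
  qed
  ultimately have "\<exists>C>0. \<forall>y. \<exists>z. T z = y \<and> norm z \<le> C * norm y"
    by (rule open_mapping_bound)
  then obtain C where C: "C > 0" "\<And>y. \<exists>z. T z = y \<and> norm z \<le> C * norm y"
    by blast
  show thesis
  proof (rule that[OF C(1)])
    fix y
    obtain z where z: "T z = y" "norm z \<le> C * norm y" using C(2) by blast
    have "norm (fst z) \<le> norm z" "norm (snd z) \<le> norm z"
      by (metis norm_fst_le norm_snd_le prod.collapse)+
    then have "norm (fst z) \<le> C * norm y" using z(2) by simp
    moreover have "cmod (apply_bcontfun (snd z) (discrete s)) \<le> C * norm y" for s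
      using norm_bounded[of "snd z" "discrete s"] \<open>norm (snd z) \<le> norm z\<close> z(2) by linarith
    ultimately show "\<exists>x c. y = A x + (\<Sum>s\<in>S. c s *\<^sub>C s) \<and> norm x \<le> C * norm y \<and>
        (\<forall>s\<in>S. cmod (c s) \<le> C * norm y)"
      using z(1) by (intro exI[of _ "fst z"] exI[of _ "\<lambda>s. apply_bcontfun (snd z) (discrete s)"]) (simp add: T_def)
  qed
qed

text \<open>
  If \<open>S\<close> is a spanning set of minimal cardinality, the coefficient of \<open>s\<close> in a decomposition
  \<open>y = A x + \<Sum> c\<^sub>s s\<close> depends on \<open>y\<close> only. It is therefore linear in \<open>y\<close>, and bounded because
  some decomposition has bounded coefficients.
\<close>

lemma cokernel_dual_basis:
  fixes A :: "'a::complex_banach \<Rightarrow>\<^bsub>CL\<^esub> 'b::complex_banach"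
  assumes S0: "finite S0" and span0: "complex_vector.span (range A \<union> S0) = UNIV"
  obtains S and h :: "'b \<Rightarrow> 'b cdual"
  where "S \<subseteq> S0" "complex_vector.span (range A \<union> S) = UNIV"
    "\<And>s x. s \<in> S \<Longrightarrow> h s (A x) = 0" "\<And>s t. s \<in> S \<Longrightarrow> t \<in> S \<Longrightarrow> h s t = (if s = t then 1 else 0)"
proof -
  let ?ok = "\<lambda>S. S \<subseteq> S0 \<and> complex_vector.span (range A \<union> S) = UNIV"
  obtain S where S: "?ok S" and min: "\<And>S'. ?ok S' \<Longrightarrow> card S \<le> card S'"
    using ex_has_least_nat[of ?ok S0 card] span0 by blast
  have fin: "finite S" using S S0 finite_subset by blast
  \<comment> \<open>A nontrivial relation would make one element of \<open>S\<close> redundant.\<close>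
  have unique: "c s = 0" if eq: "A x + (\<Sum>s\<in>S. c s *\<^sub>C s) = 0" and s: "s \<in> S" for x c s
  proof (rule ccontr)
    assume cs: "c s \<noteq> 0"
    let ?V = "complex_vector.span (range A \<union> (S - {s}))"
    have "c s *\<^sub>C s = A (- x) + (\<Sum>t\<in>S - {s}. (- c t) *\<^sub>C t)"
    proof -
      have "A x + (c s *\<^sub>C s + (\<Sum>t\<in>S - {s}. c t *\<^sub>C t)) = 0"
        using eq unfolding sum.remove[OF fin s] .
      then have "c s *\<^sub>C s = - A x - (\<Sum>t\<in>S - {s}. c t *\<^sub>C t)"
        by (simp add: eq_neg_iff_add_eq_0 algebra_simps)
      then show ?thesis
        unfolding complex_vector.scale_minus_left sum_negf cblinfun_apply_linear(3) by simp
    qed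
    also have "\<dots> \<in> ?V"
      by (intro complex_vector.span_add complex_vector.span_sum complex_vector.span_scale
          complex_vector.span_base) auto
    finally have "inverse (c s) *\<^sub>C c s *\<^sub>C s \<in> ?V" by (rule complex_vector.span_scale)
    then have "s \<in> ?V" using cs by (simp add: scaleC_one)
    then have "complex_vector.span (insert s (range A \<union> (S - {s}))) = ?V"
      by (rule complex_vector.span_redundant)
    moreover have "insert s (range A \<union> (S - {s})) = range A \<union> S" using s by blast
    ultimately have "?ok (S - {s})" using S by auto
    from min[OF this] show False using card_Diff1_less[OF fin s] by simp
  qed
  obtain C where C: "C > 0" "\<And>y. \<exists>x c. y = A x + (\<Sum>s\<in>S. c s *\<^sub>C s) \<and> norm x \<le> C * norm y \<and>
      (\<forall>s\<in>S. cmod (c s) \<le> C * norm y)"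
    using cofinite_range_bound[OF fin, of A] S by blast
  then obtain \<xi> \<gamma> where dec: "\<And>y. y = A (\<xi> y) + (\<Sum>s\<in>S. \<gamma> y s *\<^sub>C s)"
    and \<gamma>_bound: "\<And>y s. s \<in> S \<Longrightarrow> cmod (\<gamma> y s) \<le> C * norm y"
    by metis
  have \<gamma>_eq: "\<gamma> y s = c s" if y: "y = A x + (\<Sum>s\<in>S. c s *\<^sub>C s)" and s: "s \<in> S" for y x c s
  proof -
    have "A (\<xi> y - x) + (\<Sum>s\<in>S. (\<gamma> y s - c s) *\<^sub>C s) = 0"
      using dec[of y] y
      by (simp add: cblinfun_apply_linear complex_vector.scale_left_diff_distrib sum_subtractf algebra_simps)
    from unique[OF this s] show ?thesis by simp
  qed
  have h: "\<exists>f :: 'b cdual. \<forall>y. f y = \<gamma> y s" if s: "s \<in> S" for s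
  proof -
    have scaleC: "\<gamma> (c *\<^sub>C y) s = c *\<^sub>C \<gamma> y s" for c y
    proof (rule \<gamma>_eq[OF _ s, of _ "c *\<^sub>C \<xi> y"])
      show "c *\<^sub>C y = A (c *\<^sub>C \<xi> y) + (\<Sum>s\<in>S. (c *\<^sub>C \<gamma> y s) *\<^sub>C s)"
        by (subst (1) dec[of y])
          (simp add: cblinfun_scaleC scaleC_add_right complex_vector.scale_sum_right scaleC_scaleC
            scaleC_complex_def)
    qed
    have "bounded_linear (\<lambda>y. \<gamma> y s)"
    proof (rule bounded_linear_intro[where K = C])
      show "\<gamma> (y + z) s = \<gamma> y s + \<gamma> z s" for y z
      proof (rule \<gamma>_eq[OF _ s, of _ "\<xi> y + \<xi> z"])
        show "y + z = A (\<xi> y + \<xi> z) + (\<Sum>s\<in>S. (\<gamma> y s + \<gamma> z s) *\<^sub>C s)"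
          by (subst (1) dec[of y], subst (1) dec[of z])
            (simp add: cblinfun_apply_linear scaleC_add_left sum.distrib)
      qed
      show "\<gamma> (r *\<^sub>R y) s = r *\<^sub>R \<gamma> y s" for r y
        by (simp only: scaleR_scaleC scaleC)
    qed (use \<gamma>_bound[OF s] in \<open>simp add: mult.commute\<close>)
    with scaleC have "cblinfun_apply (CBlinfun (\<lambda>y. \<gamma> y s)) = (\<lambda>y. \<gamma> y s)"
      by (intro CBlinfun_inverse) auto
    then show ?thesis by (intro exI[of _ "CBlinfun (\<lambda>y. \<gamma> y s)"]) simp
  qed
  then obtain h :: "'b \<Rightarrow> 'b cdual" where h: "\<And>s y. s \<in> S \<Longrightarrow> h s y = \<gamma> y s" by metis
  show thesis
  proof (rule that[of S h])
    fix s assume s: "s \<in> S"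
    show "h s (A x) = 0" for x
      using \<gamma>_eq[OF _ s, of "A x" x "\<lambda>_. 0"] by (simp add: h[OF s])
    show "h s t = (if s = t then 1 else 0)" if "t \<in> S" for t
    proof -
      have "(\<Sum>r\<in>S. (if r = t then 1 else 0) *\<^sub>C r) = (\<Sum>r\<in>S. if r = t then r else 0)"
        by (intro sum.cong) (auto simp: scaleC_one)
      also have "\<dots> = t" using fin that by simp
      finally have "t = A 0 + (\<Sum>r\<in>S. (if r = t then 1 else 0) *\<^sub>C r)"
        by (simp add: cblinfun_apply_linear)
      from \<gamma>_eq[OF this s] show ?thesis by (simp add: h[OF s])
    qed
  qed (use S in auto)
qed

text \<open>
  Gram-Schmidt for a space \<open>G\<close> of functionals that separates the points of \<open>V\<close>. A new vector is first
  made annihilated by the functionals already chosen, so these need not be changed when a functional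
  for the new vector is added.
\<close>

lemma biorthogonal_system:
  fixes G :: "'a::complex_normed_vector cdual set" and V :: "'a set"
  assumes add: "\<And>f g. f \<in> G \<Longrightarrow> g \<in> G \<Longrightarrow> f + g \<in> G"
    and scale: "\<And>c f. f \<in> G \<Longrightarrow> c *\<^sub>C f \<in> G"
    and V: "complex_vector.subspace V"
    and sep: "\<And>v. v \<in> V \<Longrightarrow> v \<noteq> 0 \<Longrightarrow> \<exists>g\<in>G. g v \<noteq> 0"
    and S: "finite S" "S \<subseteq> V"
  shows "\<exists>U g. finite U \<and> U \<subseteq> V \<and> (\<forall>u\<in>U. g u \<in> G) \<and>
    (\<forall>u\<in>U. \<forall>v\<in>U. cblinfun_apply (g u) v = (if u = v then 1 else 0)) \<and> S \<subseteq> complex_vector.span U"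
  using S
proof (induction S rule: finite_induct)
  case empty
  then show ?case by (intro exI[of _ "{}"]) simp
next
  case (insert s S)
  from insert.prems have "S \<subseteq> V" by simp
  from insert.IH[OF this] obtain U g where "finite U \<and> U \<subseteq> V \<and> (\<forall>u\<in>U. g u \<in> G) \<and>
      (\<forall>u\<in>U. \<forall>v\<in>U. cblinfun_apply (g u) v = (if u = v then 1 else 0)) \<and> S \<subseteq> complex_vector.span U"
    by (elim exE)
  then have U: "finite U" "U \<subseteq> V" "\<And>u. u \<in> U \<Longrightarrow> g u \<in> G"
    and bi: "\<And>u v. u \<in> U \<Longrightarrow> v \<in> U \<Longrightarrow> cblinfun_apply (g u) v = (if u = v then 1 else 0)"
    and span: "S \<subseteq> complex_vector.span U"
    by simp_all
  define w where "w = (\<Sum>u\<in>U. g u s *\<^sub>C u)"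
  define v where "v = s - w"
  have wU: "w \<in> complex_vector.span U"
    unfolding w_def
    by (intro complex_vector.span_sum complex_vector.span_scale complex_vector.span_base)
  show ?case
  proof (cases "v = 0")
    case True
    then have "s \<in> complex_vector.span U" using wU by (simp add: v_def)
    with U bi span show ?thesis by (intro exI[of _ U] exI[of _ g]) simp
  next
    case False
    have "w \<in> V" using wU U(2) V complex_vector.span_minimal by blast
    then have vV: "v \<in> V"
      unfolding v_def using insert.prems V by (intro complex_vector.subspace_diff) auto
    have gv: "g u v = 0" if u: "u \<in> U" for u
    proof -
      have "g u w = (\<Sum>u'\<in>U. if u' = u then g u s else 0)"
        unfolding w_def cblinfun_apply_linear cblinfun_scaleC
        by (intro sum.cong) (use bi u in \<open>auto simp: scaleC_complex_def\<close>)
      then show ?thesis using U(1) u by (simp add: v_def cblinfun_apply_linear)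
    qed
    obtain f where f: "f \<in> G" "f v \<noteq> 0" using sep[OF vV False] by blast
    \<comment> \<open>Dual to the correction of \<open>s\<close>: subtract the values on the old vectors, then normalize.\<close>
    define f' where "f' = inverse (f v) *\<^sub>C (f + (\<Sum>u\<in>U. (- f u) *\<^sub>C g u))"
    have "0 *\<^sub>C f \<in> G" by (rule scale[OF f(1)])
    then have zeroG: "0 \<in> G" by simp
    have sumG: "(\<Sum>u\<in>U'. (- f u) *\<^sub>C g u) \<in> G" if "finite U'" "U' \<subseteq> U" for U'
      using that
    proof (induction U' rule: finite_induct)
      case (insert u U')
      have "(- f u) *\<^sub>C g u + (\<Sum>u\<in>U'. (- f u) *\<^sub>C g u) \<in> G"
        by (rule add[OF scale]) (use insert U(3) in auto)
      then show ?case unfolding sum.insert[OF insert.hyps] .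
    qed (simp add: zeroG)
    have f'G: "f' \<in> G"
      unfolding f'_def by (rule scale[OF add[OF f(1) sumG]]) (use U(1) in auto)
    have f'v: "f' v = 1"
      using f(2) gv by (simp add: f'_def cblinfun_op_apply scaleC_complex_def)
    have f'u: "f' u = 0" if u: "u \<in> U" for u
    proof -
      have "(\<Sum>u'\<in>U. (- f u') *\<^sub>C g u' u) = (\<Sum>u'\<in>U. if u' = u then - f u else 0)"
        by (intro sum.cong) (use bi u in \<open>auto simp: scaleC_complex_def\<close>)
      then show ?thesis using U(1) u by (simp add: f'_def cblinfun_op_apply scaleC_complex_def)
    qed
    have vU: "v \<notin> U" using f'u f'v by force
    let ?g = "\<lambda>u. if u = v then f' else g u"
    have "s = v + w" by (simp add: v_def)
    moreover have "v \<in> complex_vector.span (insert v U)" by (simp add: complex_vector.span_base)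
    moreover have "complex_vector.span U \<subseteq> complex_vector.span (insert v U)"
      by (intro complex_vector.span_mono) auto
    ultimately have "s \<in> complex_vector.span (insert v U)" "S \<subseteq> complex_vector.span (insert v U)"
      using span wU complex_vector.span_add[of v "insert v U" w] by blast+
    then have "insert s S \<subseteq> complex_vector.span (insert v U)" by simp
    moreover have "\<forall>u\<in>insert v U. \<forall>t\<in>insert v U. cblinfun_apply (?g u) t = (if u = t then 1 else 0)"
      using bi gv f'v f'u vU by auto
    ultimately show ?thesis
      using U vV f'G by (intro exI[of _ "insert v U"] exI[of _ ?g]) auto
  qed
qed

text \<open>
  The perturbed operator maps \<open>(x, f)\<close> to \<open>(A x + \<Sum> f(s) s, A\<^sup>* f + \<Sum> g\<^sub>u(x) g\<^sub>u)\<close>. Applying \<open>h\<^sub>s\<close> to the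
  first component recovers \<open>f(s)\<close>, since \<open>h\<^sub>s\<close> kills the range of \<open>A\<close>, and evaluating the second at \<open>u\<close>
  recovers \<open>g\<^sub>u(x)\<close>, since \<open>A u = 0\<close>. So the image controls these scalars and hence also \<open>A x\<close> and
  \<open>A\<^sup>* f\<close>. Conversely \<open>x\<close> is controlled by \<open>A x\<close> and the \<open>g\<^sub>u(x)\<close>, and \<open>f\<close> by \<open>A\<^sup>* f\<close> and the
  \<open>f(s)\<close>, because \<open>U\<close> spans the kernel of \<open>A\<close>, and the range of \<open>A\<close> together with
  \<open>S\<close> spans the space with bounded coefficients.
\<close>

theorem offdiag_perturbation_bounded_below:
  fixes A :: "'a::complex_banach \<Rightarrow>\<^bsub>CL\<^esub> 'b::complex_banach"
    and h :: "'b \<Rightarrow> 'b cdual" and g :: "'a \<Rightarrow> 'a cdual"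
  assumes S: "finite S" "complex_vector.span (range A \<union> S) = UNIV"
    and h_A: "\<And>s x. s \<in> S \<Longrightarrow> cblinfun_apply (h s) (A x) = 0"
    and h_S: "\<And>s t. s \<in> S \<Longrightarrow> t \<in> S \<Longrightarrow> cblinfun_apply (h s) t = (if s = t then 1 else 0)"
    and U: "finite U" "{x. A x = 0} \<subseteq> complex_vector.span U" "\<And>u. u \<in> U \<Longrightarrow> A u = 0"
    and g_U: "\<And>u v. u \<in> U \<Longrightarrow> v \<in> U \<Longrightarrow> cblinfun_apply (g u) v = (if u = v then 1 else 0)"
  defines "F \<equiv> cblinfun_offdiag (\<Sum>s\<in>S. rank_one s (evaluation s)) (\<Sum>u\<in>U. rank_one (g u) (g u))"
  shows "\<exists>c. \<forall>p. norm p \<le> c * norm (((A \<oplus>\<^sub>C cblinfun_adjoint A) + F) p)"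
proof -
  obtain C where C: "C > 0" "\<And>y. \<exists>x c. y = A x + (\<Sum>s\<in>S. c s *\<^sub>C s) \<and> norm x \<le> C * norm y \<and>
      (\<forall>s\<in>S. cmod (c s) \<le> C * norm y)"
    using cofinite_range_bound[OF S] by blast
  have h_sum: "h t (\<Sum>s\<in>S. c s *\<^sub>C s) = c t" if t: "t \<in> S" for t c
  proof -
    have "h t (\<Sum>s\<in>S. c s *\<^sub>C s) = (\<Sum>s\<in>S. if s = t then c s else 0)"
      unfolding cblinfun_apply_linear cblinfun_scaleC
      by (intro sum.cong) (use h_S t in \<open>auto simp: scaleC_complex_def\<close>)
    then show ?thesis using S(1) t by simp
  qed
  have g_sum: "g t (\<Sum>s\<in>U. c s *\<^sub>C s) = c t" if t: "t \<in> U" for t c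
  proof -
    have "g t (\<Sum>s\<in>U. c s *\<^sub>C s) = (\<Sum>s\<in>U. if s = t then c s else 0)"
      unfolding cblinfun_apply_linear cblinfun_scaleC
      by (intro sum.cong) (use g_U t in \<open>auto simp: scaleC_complex_def\<close>)
    then show ?thesis using U(1) t by simp
  qed
  have ker_expand: "v = (\<Sum>u\<in>U. g u v *\<^sub>C u)" if v: "A v = 0" for v
  proof -
    obtain c where c: "v = (\<Sum>u\<in>U. c u *\<^sub>C u)"
      using U(1,2) v by (auto simp: complex_vector.span_finite)
    have "(\<Sum>u\<in>U. g u v *\<^sub>C u) = (\<Sum>u\<in>U. c u *\<^sub>C u)"
      by (intro sum.cong) (simp_all add: c g_sum)
    then show ?thesis using c by simp
  qed
  have lower_A: "norm x \<le> C * norm (A x) + (\<Sum>u\<in>U. (cmod (g u x) + norm (g u) * (C * norm (A x))) * norm u)" for x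
  proof -
    obtain x' c where x': "A x = A x' + (\<Sum>s\<in>S. c s *\<^sub>C s)" "norm x' \<le> C * norm (A x)"
      using C(2) by blast
    \<comment> \<open>The preimage with norm control may differ from \<open>x\<close>, but only by an element of the kernel.\<close>
    have "c t = 0" if t: "t \<in> S" for t
      using arg_cong[OF x'(1), of "h t"] h_A[OF t] h_sum[OF t]
      by (simp add: cblinfun_apply_linear del: cblinfun_apply_linear(6))
    then have "A (x - x') = 0" using x'(1) by (simp add: cblinfun_apply_linear)
    then have "x - x' = (\<Sum>u\<in>U. g u (x - x') *\<^sub>C u)" by (rule ker_expand)
    then have "norm (x - x') \<le> (\<Sum>u\<in>U. norm (g u (x - x') *\<^sub>C u))"
      by (metis norm_sum)
    also have "\<dots> \<le> (\<Sum>u\<in>U. (cmod (g u x) + norm (g u) * (C * norm (A x))) * norm u)"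
    proof (rule sum_mono)
      fix u
      have "cmod (g u (x - x')) \<le> cmod (g u x) + cmod (g u x')"
        by (simp add: cblinfun_apply_linear norm_triangle_ineq4)
      also have "cmod (g u x') \<le> norm (g u) * (C * norm (A x))"
        using norm_cblinfun[of "g u" x'] mult_left_mono[OF x'(2), of "norm (g u)"] by simp
      finally show "norm (g u (x - x') *\<^sub>C u) \<le> (cmod (g u x) + norm (g u) * (C * norm (A x))) * norm u"
        by (simp add: norm_scaleC mult_right_mono)
    qed
    finally show ?thesis using x'(2) norm_triangle_ineq[of x' "x - x'"] by simp
  qed
  have lower_adj: "norm f \<le> C * (norm (cblinfun_adjoint A f) + (\<Sum>s\<in>S. cmod (f s)))" for f
  proof (rule norm_cblinfun_bound)
    show "0 \<le> C * (norm (cblinfun_adjoint A f) + (\<Sum>s\<in>S. cmod (f s)))"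
      using C(1) by (intro mult_nonneg_nonneg add_nonneg_nonneg sum_nonneg) auto
    fix y
    obtain x c where x: "y = A x + (\<Sum>s\<in>S. c s *\<^sub>C s)" "norm x \<le> C * norm y"
      "\<And>s. s \<in> S \<Longrightarrow> cmod (c s) \<le> C * norm y"
      using C(2)[of y] by blast
    have "f y = cblinfun_adjoint A f x + (\<Sum>s\<in>S. c s * f s)"
      by (subst x(1)) (simp add: cblinfun_apply_linear cblinfun_op_apply cblinfun_scaleC scaleC_complex_def)
    then have "norm (f y) \<le> norm (cblinfun_adjoint A f x) + (\<Sum>s\<in>S. norm (c s * f s))"
      using norm_triangle_ineq[of "cblinfun_adjoint A f x" "\<Sum>s\<in>S. c s * f s"]
        norm_sum[of "\<lambda>s. c s * f s" S] by simp
    also have "norm (cblinfun_adjoint A f x) \<le> norm (cblinfun_adjoint A f) * (C * norm y)"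
      using norm_cblinfun[of "cblinfun_adjoint A f" x] mult_left_mono[OF x(2), of "norm (cblinfun_adjoint A f)"]
      by simp
    also have "(\<Sum>s\<in>S. norm (c s * f s)) \<le> (\<Sum>s\<in>S. (C * norm y) * cmod (f s))"
      by (intro sum_mono) (simp add: norm_mult mult_right_mono x(3))
    finally show "norm (f y) \<le> C * (norm (cblinfun_adjoint A f) + (\<Sum>s\<in>S. cmod (f s))) * norm y"
      by (simp add: algebra_simps sum_distrib_left)
  qed
  define a where "a = 1 + (\<Sum>s\<in>S. norm (h s) * norm s)"
  define b where "b = 1 + (\<Sum>u\<in>U. norm u * norm (g u))"
  define c1 where "c1 = C * a + (\<Sum>u\<in>U. (norm u + norm (g u) * (C * a)) * norm u)"
  define c2 where "c2 = C * (b + (\<Sum>s\<in>S. norm (h s)))"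
  show ?thesis
  proof (intro exI[of _ "max c1 c2"] allI)
    fix p :: "('a, 'b cdual) max_sum"
    define x where "x = ms_fst p"
    define f where "f = ms_snd p"
    define q where "q = ((A \<oplus>\<^sub>C cblinfun_adjoint A) + F) p"
    define e where "e = norm q"
    have q1: "ms_fst q = A x + (\<Sum>s\<in>S. f s *\<^sub>C s)"
      and q2: "ms_snd q = cblinfun_adjoint A f + (\<Sum>u\<in>U. g u x *\<^sub>C g u)"
      by (simp_all add: q_def F_def x_def f_def cblinfun_op_apply ms_simps dsum_apply offdiag_apply
          rank_one.rep_eq evaluation.rep_eq)
    have e1: "norm (ms_fst q) \<le> e" and e2: "norm (ms_snd q) \<le> e"
      by (simp_all add: e_def norm_ms)
    have e0: "e \<ge> 0" by (simp add: e_def)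
    have fs: "cmod (f s) \<le> norm (h s) * e" if s: "s \<in> S" for s
    proof -
      have "h s (ms_fst q) = f s"
        unfolding q1 cblinfun_apply_linear(1) by (simp add: h_A[OF s] h_sum[OF s])
      then show ?thesis
        using norm_cblinfun[of "h s" "ms_fst q"] mult_left_mono[OF e1, of "norm (h s)"] by simp
    qed
    have gu: "cmod (g u x) \<le> norm u * e" if u: "u \<in> U" for u
    proof -
      have "(\<Sum>v\<in>U. g v x * g v u) = (\<Sum>v\<in>U. if v = u then g v x else 0)"
        by (intro sum.cong) (use g_U u in auto)
      then have "ms_snd q u = g u x"
        unfolding q2 using U(1,3) u
        by (simp add: cblinfun_op_apply cblinfun_apply_linear(4) scaleC_complex_def)
      then show ?thesis
        using norm_cblinfun[of "ms_snd q" u] mult_right_mono[OF e2, of "norm u"] by (simp add: mult.commute)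
    qed
    have Ax: "norm (A x) \<le> a * e"
    proof -
      have "A x = ms_fst q - (\<Sum>s\<in>S. f s *\<^sub>C s)" by (simp add: q1)
      then have "norm (A x) \<le> norm (ms_fst q) + norm (\<Sum>s\<in>S. f s *\<^sub>C s)"
        using norm_triangle_ineq4 by metis
      also have "norm (\<Sum>s\<in>S. f s *\<^sub>C s) \<le> (\<Sum>s\<in>S. (norm (h s) * e) * norm s)"
        by (rule sum_norm_le) (simp add: norm_scaleC mult_right_mono fs)
      finally show ?thesis using e1 by (simp add: a_def algebra_simps sum_distrib_left)
    qed
    have Af: "norm (cblinfun_adjoint A f) \<le> b * e"
    proof -
      have "cblinfun_adjoint A f = ms_snd q - (\<Sum>u\<in>U. g u x *\<^sub>C g u)" by (simp add: q2)
      then have "norm (cblinfun_adjoint A f) \<le> norm (ms_snd q) + norm (\<Sum>u\<in>U. g u x *\<^sub>C g u)"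
        using norm_triangle_ineq4 by metis
      also have "norm (\<Sum>u\<in>U. g u x *\<^sub>C g u) \<le> (\<Sum>u\<in>U. (norm u * e) * norm (g u))"
        by (rule sum_norm_le) (simp add: norm_scaleC mult_right_mono gu)
      finally show ?thesis using e2 by (simp add: b_def algebra_simps sum_distrib_left)
    qed
    have "norm x \<le> c1 * e"
    proof -
      have CA: "C * norm (A x) \<le> C * (a * e)" using Ax C(1) by simp
      have "(cmod (g u x) + norm (g u) * (C * norm (A x))) * norm u
          \<le> (norm u * e + norm (g u) * (C * (a * e))) * norm u" if "u \<in> U" for u
        by (intro mult_right_mono add_mono mult_left_mono CA gu that) auto
      then have "norm x \<le> C * (a * e) + (\<Sum>u\<in>U. (norm u * e + norm (g u) * (C * (a * e))) * norm u)"
        by (intro order_trans[OF lower_A[of x]] add_mono CA sum_mono)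
      then show ?thesis by (simp add: c1_def algebra_simps sum_distrib_left)
    qed
    moreover have "norm f \<le> c2 * e"
    proof -
      have "(\<Sum>s\<in>S. cmod (f s)) \<le> (\<Sum>s\<in>S. norm (h s) * e)"
        by (intro sum_mono fs)
      then have "C * (norm (cblinfun_adjoint A f) + (\<Sum>s\<in>S. cmod (f s)))
          \<le> C * (b * e + (\<Sum>s\<in>S. norm (h s) * e))"
        using C(1) Af by (intro mult_left_mono add_mono) auto
      with lower_adj[of f] have "norm f \<le> C * (b * e + (\<Sum>s\<in>S. norm (h s) * e))" by linarith
      then show ?thesis by (simp add: c2_def algebra_simps sum_distrib_left)
    qed
    moreover have "c1 * e \<le> max c1 c2 * e" "c2 * e \<le> max c1 c2 * e"
      using e0 by (simp_all add: mult_right_mono)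
    ultimately have "norm p \<le> max c1 c2 * e"
      unfolding norm_ms[of p] x_def f_def by simp
    then show "norm p \<le> max c1 c2 * norm (((A \<oplus>\<^sub>C cblinfun_adjoint A) + F) p)"
      by (simp add: e_def q_def)
  qed
qed

section \<open>The algebra of a projection sequence\<close>

lemma Pcompact_limit:
  assumes X: "\<And>k. X k \<in> Pcompact P" and lim: "X \<longlonglongrightarrow> Y" and nested: "nested_projections P"
  shows "Y \<in> Pcompact P"
proof -
  interpret nested_projections P by fact
  have small: "\<exists>k. norm (X k - Y) < e" if "e > 0" for e
    using LIMSEQ_D[OF lim that] by blast
  have "(\<lambda>n. norm (Q n o\<^sub>C Y)) \<longlonglongrightarrow> 0"
  proof (rule LIMSEQ_I)
    fix e :: real assume e: "e > 0"
    obtain k where k: "norm (X k - Y) < e / 2" using small[of "e / 2"] e by auto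
    obtain N where N: "\<And>n. n \<ge> N \<Longrightarrow> norm (norm (Q n o\<^sub>C X k) - 0) < e / 2"
      using LIMSEQ_D[of "\<lambda>n. norm (Q n o\<^sub>C X k)" 0 "e / 2"] X[of k] e by (auto simp: Pcompact_iff)
    have "norm (norm (Q n o\<^sub>C Y) - 0) < e" if n: "n \<ge> N" for n
    proof -
      have "Q n o\<^sub>C Y = Q n o\<^sub>C X k - Q n o\<^sub>C (X k - Y)"
        by (simp add: cblinfun_compose_algebra)
      then have "norm (Q n o\<^sub>C Y) \<le> norm (Q n o\<^sub>C X k) + norm (Q n o\<^sub>C (X k - Y))"
        by (metis norm_triangle_ineq4)
      moreover have "norm (Q n o\<^sub>C (X k - Y)) \<le> 1 * norm (X k - Y)"
        by (intro norm_compose_le norm_Q order_refl)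
      ultimately show ?thesis using k N[OF n] by simp
    qed
    then show "\<exists>N. \<forall>n\<ge>N. norm (norm (Q n o\<^sub>C Y) - 0) < e" by blast
  qed
  moreover have "(\<lambda>n. norm (Y o\<^sub>C Q n)) \<longlonglongrightarrow> 0"
  proof (rule LIMSEQ_I)
    fix e :: real assume e: "e > 0"
    obtain k where k: "norm (X k - Y) < e / 2" using small[of "e / 2"] e by auto
    obtain N where N: "\<And>n. n \<ge> N \<Longrightarrow> norm (norm (X k o\<^sub>C Q n) - 0) < e / 2"
      using LIMSEQ_D[of "\<lambda>n. norm (X k o\<^sub>C Q n)" 0 "e / 2"] X[of k] e by (auto simp: Pcompact_iff)
    have "norm (norm (Y o\<^sub>C Q n) - 0) < e" if n: "n \<ge> N" for n
    proof -
      have "Y o\<^sub>C Q n = X k o\<^sub>C Q n - (X k - Y) o\<^sub>C Q n"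
        by (simp add: cblinfun_compose_algebra)
      then have "norm (Y o\<^sub>C Q n) \<le> norm (X k o\<^sub>C Q n) + norm ((X k - Y) o\<^sub>C Q n)"
        by (metis norm_triangle_ineq4)
      moreover have "norm ((X k - Y) o\<^sub>C Q n) \<le> norm (X k - Y) * 1"
        by (intro norm_compose_le norm_Q order_refl)
      ultimately show ?thesis using k N[OF n] by simp
    qed
    then show "\<exists>N. \<forall>n\<ge>N. norm (norm (Y o\<^sub>C Q n) - 0) < e" by blast
  qed
  ultimately show ?thesis by (simp add: Pcompact_iff)
qed

context nested_projections
begin

text \<open>
  Sufficient because every \<open>\<P>\<close>-compact \<open>K\<close> is the norm limit of \<open>P\<^sub>k K\<close> and of \<open>K P\<^sub>k\<close>, and the
  \<open>\<P>\<close>-compact operators form a closed set.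
\<close>

lemma PalgI:
  assumes "\<And>k. A o\<^sub>C P k \<in> Pcompact P" "\<And>k. P k o\<^sub>C A \<in> Pcompact P"
  shows "A \<in> Palg P"
  unfolding Palg_def
proof (intro CollectI ballI conjI)
  fix K assume K: "K \<in> Pcompact P"
  have lim_left: "(\<lambda>k. P k o\<^sub>C K) \<longlonglongrightarrow> K"
  proof (rule LIM_zero_cancel, rule tendsto_norm_zero_cancel)
    have "norm (P k o\<^sub>C K - K) = norm (Q k o\<^sub>C K)" for k
      by (simp add: cproj_def cblinfun_compose_algebra norm_minus_commute)
    then show "(\<lambda>k. norm (P k o\<^sub>C K - K)) \<longlonglongrightarrow> 0" using K by (simp add: Pcompact_iff)
  qed
  have lim_right: "(\<lambda>k. K o\<^sub>C P k) \<longlonglongrightarrow> K"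
  proof (rule LIM_zero_cancel, rule tendsto_norm_zero_cancel)
    have "norm (K o\<^sub>C P k - K) = norm (K o\<^sub>C Q k)" for k
      by (simp add: cproj_def cblinfun_compose_algebra norm_minus_commute)
    then show "(\<lambda>k. norm (K o\<^sub>C P k - K)) \<longlonglongrightarrow> 0" using K by (simp add: Pcompact_iff)
  qed
  have left: "bounded_linear (\<lambda>X. A o\<^sub>C X)"
    by (rule bounded_linear_intro[where K = "norm A"])
      (simp_all add: cblinfun_compose_algebra norm_cblinfun_compose mult.commute[of "norm _" "norm A"])
  have right: "bounded_linear (\<lambda>X. X o\<^sub>C A)"
    by (rule bounded_linear_intro[where K = "norm A"])
      (simp_all add: cblinfun_compose_algebra norm_cblinfun_compose)
  show "A o\<^sub>C K \<in> Pcompact P"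
  proof (rule Pcompact_limit[OF _ bounded_linear.tendsto[OF left lim_left]])
    show "A o\<^sub>C (P k o\<^sub>C K) \<in> Pcompact P" for k
      using Pcompact_compose[OF assms(1) K] by (simp add: cblinfun_compose_assoc)
  qed unfold_locales
  show "K o\<^sub>C A \<in> Pcompact P"
  proof (rule Pcompact_limit[OF _ bounded_linear.tendsto[OF right lim_right]])
    show "(K o\<^sub>C P k) o\<^sub>C A \<in> Pcompact P" for k
      using Pcompact_compose[OF K assms(2)] by (simp add: cblinfun_compose_assoc)
  qed unfold_locales
qed

lemma Palg_compose_P:
  assumes "A \<in> Palg P"
  shows "A o\<^sub>C P k \<in> Pcompact P" "P k o\<^sub>C A \<in> Pcompact P"
  using assms P_Pcompact by (auto simp: Palg_def)

end

lemma norm_tendsto_zero_dsum: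
  assumes "(\<lambda>n. norm (f n)) \<longlonglongrightarrow> 0" "(\<lambda>n. norm (g n)) \<longlonglongrightarrow> 0"
  shows "(\<lambda>n. norm (f n \<oplus>\<^sub>C g n)) \<longlonglongrightarrow> 0"
proof (rule tendsto_sandwich[OF _ _ tendsto_const])
  show "(\<lambda>n. max (norm (f n)) (norm (g n))) \<longlonglongrightarrow> 0"
    using tendsto_max[OF assms] by simp
qed (simp_all add: norm_dsum_le)

lemma norm_tendsto_zero_offdiag:
  assumes "(\<lambda>n. norm (f n)) \<longlonglongrightarrow> 0" "(\<lambda>n. norm (g n)) \<longlonglongrightarrow> 0"
  shows "(\<lambda>n. norm (cblinfun_offdiag (f n) (g n))) \<longlonglongrightarrow> 0"
proof (rule tendsto_sandwich[OF _ _ tendsto_const])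
  show "(\<lambda>n. max (norm (f n)) (norm (g n))) \<longlonglongrightarrow> 0"
    using tendsto_max[OF assms] by simp
qed (simp_all add: norm_offdiag_le)

lemma norm_tendsto_zero_adjoint:
  assumes "(\<lambda>n. norm (f n)) \<longlonglongrightarrow> 0"
  shows "(\<lambda>n. norm (cblinfun_adjoint (f n))) \<longlonglongrightarrow> 0"
  by (rule tendsto_sandwich[OF _ _ tendsto_const assms]) (simp_all add: norm_adjoint_le)

lemma Pcompact_dsum_adjoint:
  assumes "K \<in> Pcompact P" "L \<in> Pcompact P"
  shows "K \<oplus>\<^sub>C cblinfun_adjoint L \<in> Pcompact (dsum_seq P (adjoint_seq P))"
  using assms
  unfolding Pcompact_iff cproj_dsum_seq cproj_adjoint_seq dsum_compose adjoint_compose[symmetric]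
  by (intro conjI norm_tendsto_zero_dsum norm_tendsto_zero_adjoint) simp_all

lemma dsum_adjoint_Palg:
  assumes nested: "nested_projections P" and R: "R \<in> Palg P"
  shows "R \<oplus>\<^sub>C cblinfun_adjoint R \<in> Palg (dsum_seq P (adjoint_seq P))"
    "(R \<oplus>\<^sub>C cblinfun_adjoint R) o\<^sub>C dsum_seq P (adjoint_seq P) k \<in> Pcompact (dsum_seq P (adjoint_seq P))"
proof -
  interpret nested_projections P by fact
  interpret Z: nested_projections "dsum_seq P (adjoint_seq P)"
    by (intro nested_projections_dsum nested_projections_adjoint nested)
  show 1: "(R \<oplus>\<^sub>C cblinfun_adjoint R) o\<^sub>C dsum_seq P (adjoint_seq P) k \<in> Pcompact (dsum_seq P (adjoint_seq P))" for k
    unfolding dsum_seq_def[of P "adjoint_seq P" k] adjoint_seq_def[of P k] dsum_compose adjoint_compose[symmetric]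
    by (intro Pcompact_dsum_adjoint Palg_compose_P R)
  have 2: "dsum_seq P (adjoint_seq P) k o\<^sub>C (R \<oplus>\<^sub>C cblinfun_adjoint R) \<in> Pcompact (dsum_seq P (adjoint_seq P))" for k
    unfolding dsum_seq_def[of P "adjoint_seq P" k] adjoint_seq_def[of P k] dsum_compose adjoint_compose[symmetric]
    by (intro Pcompact_dsum_adjoint Palg_compose_P R)
  from 1 2 show "R \<oplus>\<^sub>C cblinfun_adjoint R \<in> Palg (dsum_seq P (adjoint_seq P))"
    by (rule Z.PalgI)
qed

lemma norm_tendsto_zero_rank_one_sum:
  assumes "finite S" "\<And>s. s \<in> S \<Longrightarrow> (\<lambda>n. norm (v n s) * norm (\<phi> n s)) \<longlonglongrightarrow> 0"
  shows "(\<lambda>n. norm (\<Sum>s\<in>S. rank_one (v n s) (\<phi> n s))) \<longlonglongrightarrow> 0"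
proof (rule tendsto_sandwich[OF _ _ tendsto_const])
  show "(\<lambda>n. \<Sum>s\<in>S. norm (v n s) * norm (\<phi> n s)) \<longlonglongrightarrow> 0"
    by (rule tendsto_null_sum) (rule assms)
  show "\<forall>\<^sub>F n in sequentially. norm (\<Sum>s\<in>S. rank_one (v n s) (\<phi> n s)) \<le> (\<Sum>s\<in>S. norm (v n s) * norm (\<phi> n s))"
    by (intro always_eventually allI sum_norm_le norm_rank_one_le)
qed simp

text \<open>
  A rank-one operator \<open>v \<otimes> \<phi>\<close> is \<open>\<P>\<close>-compact as soon as \<open>\<parallel>Q\<^sub>n v\<parallel>\<close> and \<open>\<parallel>\<phi> Q\<^sub>n\<parallel>\<close> tend to zero. In the
  entries used here the functional and the vector come from the same element of the space or of its
  dual, so that one condition on each of them is enough.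
\<close>

lemma Pcompact_offdiag_finite_rank:
  fixes P :: "nat \<Rightarrow> 'a::complex_banach endo" and g :: "'a \<Rightarrow> 'a cdual"
  assumes S: "finite S" "\<And>s. s \<in> S \<Longrightarrow> (\<lambda>n. norm (cproj P n s)) \<longlonglongrightarrow> 0"
    and U: "finite U" "\<And>u. u \<in> U \<Longrightarrow> (\<lambda>n. norm (g u o\<^sub>C cproj P n)) \<longlonglongrightarrow> 0"
  shows "cblinfun_offdiag (\<Sum>s\<in>S. rank_one s (evaluation s)) (\<Sum>u\<in>U. rank_one (g u) (g u))
    \<in> Pcompact (dsum_seq P (adjoint_seq P))"
proof -
  have eval: "(\<lambda>n. norm (evaluation (cproj P n s))) \<longlonglongrightarrow> 0" if "s \<in> S" for s
    by (rule tendsto_sandwich[OF _ _ tendsto_const S(2)[OF that]]) (simp_all add: norm_evaluation_le)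
  show ?thesis
    unfolding Pcompact_iff cproj_dsum_seq cproj_adjoint_seq dsum_offdiag_compose
      cblinfun_compose_sum_left cblinfun_compose_sum_right compose_rank_one rank_one_compose evaluation_adjoint
      cblinfun_adjoint.rep_eq
    by (intro conjI norm_tendsto_zero_offdiag norm_tendsto_zero_rank_one_sum S(1) U(1)
        tendsto_mult_left_zero tendsto_mult_right_zero eval S(2) U(2))
qed

section \<open>The inverse coset\<close>

lemma Pcoset_iff: "B \<in> Pcoset P A \<longleftrightarrow> B - A \<in> Pcompact P"
  unfolding Pcoset_def a_r_coset_def' Pring_def
  by (auto simp: algebra_simps) (metis add_diff_cancel_left' add_diff_eq diff_add_cancel)

lemma Palg_add: "A \<in> Palg P \<Longrightarrow> B \<in> Palg P \<Longrightarrow> A + B \<in> Palg P"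
  by (auto simp: Palg_def cblinfun_compose_algebra intro: Pcompact_add)

definition regularizes :: "(nat \<Rightarrow> 'a::complex_banach endo) \<Rightarrow> 'a endo \<Rightarrow> 'a endo \<Rightarrow> bool"
  where "regularizes P A R \<longleftrightarrow> R \<in> Palg P \<and>
    R o\<^sub>C A - cblinfun_id \<in> Pcompact P \<and> A o\<^sub>C R - cblinfun_id \<in> Pcompact P"

lemma regularizes_perturb:
  assumes R: "regularizes P A R" and A: "A \<in> Palg P" and K: "K \<in> Pcompact P" and L: "L \<in> Pcompact P"
  shows "regularizes P (A + L) (R + K)"
proof -
  have "K o\<^sub>C A \<in> Pcompact P" "A o\<^sub>C K \<in> Pcompact P" "R o\<^sub>C L \<in> Pcompact P" "L o\<^sub>C R \<in> Pcompact P"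
    "K o\<^sub>C L \<in> Pcompact P" "L o\<^sub>C K \<in> Pcompact P"
    using assms by (auto simp: Palg_def regularizes_def intro: Pcompact_compose)
  then have "(R o\<^sub>C A - cblinfun_id) + (R o\<^sub>C L + (K o\<^sub>C A + K o\<^sub>C L)) \<in> Pcompact P"
    "(A o\<^sub>C R - cblinfun_id) + (A o\<^sub>C K + (L o\<^sub>C R + L o\<^sub>C K)) \<in> Pcompact P"
    using R by (simp_all only: regularizes_def Pcompact_add)
  moreover have "(R o\<^sub>C A - cblinfun_id) + (R o\<^sub>C L + (K o\<^sub>C A + K o\<^sub>C L))
      = (R + K) o\<^sub>C (A + L) - cblinfun_id"
    "(A o\<^sub>C R - cblinfun_id) + (A o\<^sub>C K + (L o\<^sub>C R + L o\<^sub>C K))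
      = (A + L) o\<^sub>C (R + K) - cblinfun_id"
    by (simp_all add: cblinfun_compose_algebra)
  moreover have "R + K \<in> Palg P"
    using R K Pcompact_subset_Palg by (auto simp: regularizes_def intro: Palg_add)
  ultimately show ?thesis
    by (simp only: regularizes_def)
qed

lemma inverse_coset_regularizers:
  assumes "P_Fredholm P A"
  defines "X \<equiv> inv\<^bsub>Pquot P\<^esub> (Pcoset P A)"
  shows "X \<noteq> {}" and "\<And>R. R \<in> X \<Longrightarrow> regularizes P A R"
    and "\<And>R K. R \<in> X \<Longrightarrow> K \<in> Pcompact P \<Longrightarrow> R + K \<in> X"
proof -
  interpret I: ideal "Pcompact P" "Pring P" by (rule ideal_Pcompact)
  interpret Quo: Ring.ring "Pquot P" unfolding Pquot_def by (rule I.quotient_is_ring)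
  have A: "A \<in> Palg P" and unit: "Pcoset P A \<in> Units (Pquot P)"
    using assms by (simp_all add: P_Fredholm_def)
  have "X \<in> carrier (Pquot P)" unfolding X_def using unit by (rule Quo.Units_inv_closed)
  then obtain R0 where R0: "R0 \<in> Palg P" and X: "X = Pcoset P R0"
    by (auto simp: Pquot_def FactRing_def A_RCOSETS_defs Pcoset_def a_r_coset_def Pring_def)
  have mult: "Pcoset P B \<otimes>\<^bsub>Pquot P\<^esub> Pcoset P C = Pcoset P (B o\<^sub>C C)"
    if "B \<in> Palg P" "C \<in> Palg P" for B C
    using I.rcoset_mult_add[of B C] that
    by (simp add: Pquot_def FactRing_def Pcoset_def) (simp add: Pring_def)
  have one: "\<one>\<^bsub>Pquot P\<^esub> = Pcoset P cblinfun_id"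
    by (simp add: Pquot_def FactRing_def Pcoset_def) (simp add: Pring_def)
  have "Pcoset P (R0 o\<^sub>C A) = Pcoset P cblinfun_id" "Pcoset P (A o\<^sub>C R0) = Pcoset P cblinfun_id"
    using Quo.Units_l_inv[OF unit] Quo.Units_r_inv[OF unit] mult[OF R0 A] mult[OF A R0]
    unfolding one X_def[symmetric] X by simp_all
  moreover have "B \<in> Pcoset P B" for B by (simp add: Pcoset_iff Pcompact_zero)
  ultimately have reg0: "regularizes P A R0"
    using R0 unfolding regularizes_def by (metis Pcoset_iff)
  show "X \<noteq> {}" using X \<open>R0 \<in> Pcoset P R0\<close> by blast
  show "regularizes P A R" if "R \<in> X" for R
    using regularizes_perturb[OF reg0 A, of "R - R0" 0] that
    by (simp add: X Pcoset_iff Pcompact_zero)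
  show "R + K \<in> X" if "R \<in> X" "K \<in> Pcompact P" for R K
    using Pcompact_add[of "R - R0" P K] that by (simp add: X Pcoset_iff algebra_simps)
qed

lemma coset_norm_le: "B \<in> C \<Longrightarrow> coset_norm C \<le> norm B"
  unfolding coset_norm_def by (rule cINF_lower) (auto intro: bdd_belowI2[where m = 0])

lemma coset_norm_greatest: "C \<noteq> {} \<Longrightarrow> (\<And>B. B \<in> C \<Longrightarrow> b \<le> norm B) \<Longrightarrow> b \<le> coset_norm C"
  unfolding coset_norm_def by (rule cINF_greatest) auto

context nested_projections
begin

text \<open>
  On unit vectors of \<open>im Q\<^sub>m\<close> the product \<open>A R\<close> is almost the identity. In particular the quotient norm of
  the inverse coset is positive, so that its reciprocal is not a default value.
\<close>

lemma regularizer_norm_ge: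
  assumes "regularizes P A R"
  shows "1 \<le> norm A * norm R"
proof (rule LIMSEQ_le_const[where X = "\<lambda>m. norm A * norm R + norm ((A o\<^sub>C R - cblinfun_id) o\<^sub>C Q m)"])
  let ?M = "A o\<^sub>C R - cblinfun_id"
  have "(\<lambda>m. norm (?M o\<^sub>C Q m)) \<longlonglongrightarrow> 0"
    using assms by (simp add: regularizes_def Pcompact_iff)
  from tendsto_add[OF tendsto_const this]
  show "(\<lambda>m. norm A * norm R + norm (?M o\<^sub>C Q m)) \<longlonglongrightarrow> norm A * norm R" by simp
  have "1 \<le> norm A * norm R + norm (?M o\<^sub>C Q m)" for m
  proof -
    obtain x where x: "x \<in> range (Q m)" "norm x = 1" using exists_unit_range_Q by blast
    have "x = (A o\<^sub>C R) x - (?M o\<^sub>C Q m) x"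
      by (simp add: cblinfun_op_apply Q_apply_range[OF x(1)])
    then have "norm x \<le> norm ((A o\<^sub>C R) x) + norm ((?M o\<^sub>C Q m) x)"
      by (metis norm_triangle_ineq4)
    also have "\<dots> \<le> norm A * norm R * norm x + norm (?M o\<^sub>C Q m) * norm x"
      by (intro add_mono norm_cblinfun order_trans[OF norm_cblinfun] mult_right_mono
          norm_cblinfun_compose) simp
    finally show ?thesis using x by simp
  qed
  then show "\<exists>N. \<forall>m\<ge>N. 1 \<le> norm A * norm R + norm (?M o\<^sub>C Q m)" by blast
qed

lemma compress_regularizer:
  assumes "R \<in> Palg P"
  shows "Q n o\<^sub>C R o\<^sub>C Q m - R \<in> Pcompact P"
proof -
  have "Q n o\<^sub>C R o\<^sub>C Q m - R = (P n o\<^sub>C R) o\<^sub>C P m - (P n o\<^sub>C R) - R o\<^sub>C P m"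
    by (simp add: cproj_def cblinfun_compose_algebra)
  moreover have "(P n o\<^sub>C R) o\<^sub>C P m \<in> Pcompact P"
    by (intro Pcompact_compose Palg_compose_P P_Pcompact assms)
  ultimately show ?thesis
    using Palg_compose_P[OF assms] by (simp add: Pcompact_diff)
qed

theorem mu_tilde_le_inverse_coset_norm:
  assumes A: "P_Fredholm P A"
  defines "X \<equiv> inv\<^bsub>Pquot P\<^esub> (Pcoset P A)"
  shows "coset_norm X > 0" and "mu_tilde P A \<le> inverse (coset_norm X)"
proof -
  note X = inverse_coset_regularizers[OF A, folded X_def]
  let ?q = "coset_norm X"
  obtain R where R: "R \<in> X" using X(1) by blast
  note reg = X(2)[OF R]
  have RP: "R \<in> Palg P" using reg by (simp add: regularizes_def)
  let ?M = "A o\<^sub>C R - cblinfun_id"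
  have "norm A > 0"
    using regularizer_norm_ge[OF reg] by (auto intro: ccontr)
  then have "1 / norm A \<le> ?q"
    using regularizer_norm_ge[OF X(2)] by (intro coset_norm_greatest X(1)) (simp add: field_simps)
  then show q: "?q > 0"
    using \<open>norm A > 0\<close> by (meson divide_pos_pos less_le_trans zero_less_one)
  \<comment> \<open>For fixed \<open>n\<close> the lower norm of \<open>A\<close> on \<open>im Q\<^sub>n\<close> is tested on \<open>Q\<^sub>n R Q\<^sub>m\<close> and \<open>m\<close> tends to infinity.\<close>
  have "lower_Q n A * ?q \<le> 1" for n
  proof (cases "lower_Q n A > 0")
    case False
    then have "lower_Q n A * ?q \<le> 0" using q by (simp add: mult_le_0_iff)
    then show ?thesis by simp
  next
    case True
    let ?l = "lower_Q n A"
    let ?s = "\<lambda>m. 1 + norm (?M o\<^sub>C Q m) + norm A * norm ((P n o\<^sub>C R) o\<^sub>C Q m)"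
    have bound: "?l * ?q \<le> ?s m" for m
    proof -
      let ?T = "Q n o\<^sub>C R o\<^sub>C Q m"
      have "norm ?T \<le> ?s m / ?l"
      proof (rule norm_cblinfun_bound)
        show "0 \<le> ?s m / ?l" using True by (intro divide_nonneg_pos add_nonneg_nonneg) auto
        fix y
        have "?l * norm (?T y) \<le> norm (A (?T y))"
          by (rule lower_norm_range_mult_le) (simp add: cblinfun_op_apply)
        also have "A (?T y) = Q m y + (?M o\<^sub>C Q m) y - A (((P n o\<^sub>C R) o\<^sub>C Q m) y)"
          by (simp add: cproj_def[of P n] cblinfun_op_apply cblinfun_apply_linear)
        also have "norm \<dots> \<le> norm (Q m y) + norm ((?M o\<^sub>C Q m) y) + norm (A (((P n o\<^sub>C R) o\<^sub>C Q m) y))"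
          by (intro order_trans[OF norm_triangle_ineq4] add_mono norm_triangle_ineq order_refl)
        also have "\<dots> \<le> 1 * norm y + norm (?M o\<^sub>C Q m) * norm y
            + norm A * (norm ((P n o\<^sub>C R) o\<^sub>C Q m) * norm y)"
          by (intro add_mono norm_cblinfun order_trans[OF norm_cblinfun[of "Q m"]]
              order_trans[OF norm_cblinfun[of A]] mult_left_mono mult_right_mono norm_Q) auto
        finally show "norm (?T y) \<le> ?s m / ?l * norm y"
          using True by (simp add: field_simps)
      qed
      moreover have "?q \<le> norm ?T"
        using X(3)[OF R compress_regularizer[OF RP, of n m]] by (intro coset_norm_le) simp
      ultimately have "?q \<le> ?s m / ?l" by linarith
      then show ?thesis using True by (simp add: field_simps)
    qed
    have "?s \<longlonglongrightarrow> 1 + 0 + norm A * 0"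
      using reg Palg_compose_P(2)[OF RP, of n]
      by (intro tendsto_intros) (simp_all add: regularizes_def Pcompact_iff)
    then show ?thesis
      using bound by (intro LIMSEQ_le_const[where X = ?s]) auto
  qed
  then have "mu_tilde P A * ?q \<le> 1"
    by (intro LIMSEQ_le_const2[OF tendsto_mult_right[OF lower_Q_tendsto]]) auto
  then show "mu_tilde P A \<le> inverse ?q"
    using q by (simp add: field_simps)
qed

section \<open>Kernels and cokernels of P-Fredholm operators that are Fredholm\<close>

text \<open>
  Arbitrary vectors \<open>t\<close> spanning a complement of the range need not satisfy \<open>Q\<^sub>n t \<rightarrow> 0\<close>, but modulo the range
  \<open>t\<close> is \<open>- (B R - I) t\<close>, and vectors of this form do, since \<open>B R - I\<close> is \<open>\<P>\<close>-compact.
\<close>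

lemma fredholm_cokernel_system:
  assumes fred: "fredholm B" and reg: "regularizes P B R"
  obtains S and h :: "'a \<Rightarrow> 'a cdual"
  where "finite S" "complex_vector.span (range B \<union> S) = UNIV"
    "\<And>s. s \<in> S \<Longrightarrow> (\<lambda>n. norm (Q n s)) \<longlonglongrightarrow> 0"
    "\<And>s x. s \<in> S \<Longrightarrow> h s (B x) = 0" "\<And>s t. s \<in> S \<Longrightarrow> t \<in> S \<Longrightarrow> h s t = (if s = t then 1 else 0)"
proof -
  let ?M = "B o\<^sub>C R - cblinfun_id"
  obtain S1 where S1: "finite S1" "complex_vector.span (range B \<union> S1) = UNIV"
    using fred by (auto simp: fredholm_def)
  let ?V = "complex_vector.span (range B \<union> ?M ` S1)"
  have "s \<in> ?V" if "s \<in> S1" for s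
  proof -
    have "B (R s) - ?M s \<in> ?V"
      by (intro complex_vector.span_diff complex_vector.span_base) (use that in auto)
    then show ?thesis by (simp add: cblinfun_op_apply)
  qed
  moreover have "range B \<subseteq> ?V"
    by (rule order_trans[OF Un_upper1 complex_vector.span_superset])
  ultimately have "range B \<union> S1 \<subseteq> ?V" by blast
  then have V: "?V = UNIV"
    using complex_vector.span_minimal[OF _ complex_vector.subspace_span] S1(2) by blast
  obtain S and h :: "'a \<Rightarrow> 'a cdual" where S: "S \<subseteq> ?M ` S1" "complex_vector.span (range B \<union> S) = UNIV"
    "\<And>s x. s \<in> S \<Longrightarrow> h s (B x) = 0" "\<And>s t. s \<in> S \<Longrightarrow> t \<in> S \<Longrightarrow> h s t = (if s = t then 1 else 0)"
    by (rule cokernel_dual_basis[OF finite_imageI[OF S1(1)] V]) blast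
  have "(\<lambda>n. norm (Q n s)) \<longlonglongrightarrow> 0" if s: "s \<in> S" for s
  proof -
    obtain t where t: "s = ?M t" using S(1) s by blast
    have "(\<lambda>n. norm (Q n o\<^sub>C ?M) * norm t) \<longlonglongrightarrow> 0"
      using reg by (intro tendsto_mult_left_zero) (simp add: regularizes_def Pcompact_iff)
    then show ?thesis
    proof (rule tendsto_sandwich[OF _ _ tendsto_const, rotated 2])
      show "\<forall>\<^sub>F n in sequentially. norm (Q n s) \<le> norm (Q n o\<^sub>C ?M) * norm t"
        using norm_cblinfun[of "Q _ o\<^sub>C ?M" t] unfolding t
        by (intro always_eventually allI) (simp add: cblinfun_compose.rep_eq)
    qed simp
  qed
  with S S1(1) show thesis
    by (intro that[of S h]) (auto intro: finite_subset)
qed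

text \<open>
  On the kernel of \<open>B\<close> the \<open>\<P>\<close>-compact operator \<open>R B - I\<close> is \<open>- I\<close>, so \<open>Q\<^sub>n v \<rightarrow> 0\<close> for \<open>v\<close> in the kernel.
  Some \<open>P\<^sub>n v\<close> is therefore nonzero if \<open>v\<close> is, and functionals of the form \<open>f P\<^sub>n\<close>, which satisfy the
  required decay, already separate the points of the kernel.
\<close>

lemma fredholm_kernel_system:
  assumes fred: "fredholm B" and reg: "regularizes P B R"
  obtains U and g :: "'a \<Rightarrow> 'a cdual"
  where "finite U" "{x. B x = 0} \<subseteq> complex_vector.span U" "\<And>u. u \<in> U \<Longrightarrow> B u = 0"
    "\<And>u. u \<in> U \<Longrightarrow> (\<lambda>n. norm (g u o\<^sub>C Q n)) \<longlonglongrightarrow> 0"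
    "\<And>u v. u \<in> U \<Longrightarrow> v \<in> U \<Longrightarrow> g u v = (if u = v then 1 else 0)"
proof -
  let ?V = "{x. B x = 0}"
  let ?G = "{g :: 'a cdual. (\<lambda>n. norm (g o\<^sub>C Q n)) \<longlonglongrightarrow> 0}"
  let ?L = "R o\<^sub>C B - cblinfun_id"
  obtain S0 where S0: "finite S0" "?V \<subseteq> complex_vector.span S0"
    using fred by (auto simp: fredholm_def)
  obtain S where S: "S \<subseteq> ?V" "complex_vector.independent S" "?V \<subseteq> complex_vector.span S"
    using complex_vector.maximal_independent_subset by blast
  have finS: "finite S"
    using complex_vector.independent_span_bound[OF S0(1) S(2)] S(1) S0(2) by blast
  have "\<exists>U g. finite U \<and> U \<subseteq> ?V \<and> (\<forall>u\<in>U. g u \<in> ?G) \<and>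
    (\<forall>u\<in>U. \<forall>v\<in>U. cblinfun_apply (g u) v = (if u = v then 1 else 0)) \<and> S \<subseteq> complex_vector.span U"
  proof (rule biorthogonal_system[OF _ _ _ _ finS S(1)])
    show "f + g \<in> ?G" if "f \<in> ?G" "g \<in> ?G" for f g
    proof -
      have "(\<lambda>n. f o\<^sub>C Q n + g o\<^sub>C Q n) \<longlonglongrightarrow> 0"
        using that by (intro tendsto_add_zero) (auto intro: tendsto_norm_zero_cancel)
      then show ?thesis by (simp add: cblinfun_compose_add_left tendsto_norm_zero)
    qed
    show "c *\<^sub>C f \<in> ?G" if "f \<in> ?G" for c f
      using that by (simp add: cblinfun_compose_scaleC_left norm_scaleC tendsto_mult_right_zero)
    show "complex_vector.subspace ?V"
      by (rule complex_vector.subspaceI) (simp_all add: cblinfun_apply_linear cblinfun_scaleC)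
    fix v assume v: "v \<in> ?V" "v \<noteq> 0"
    have "\<exists>n. P n v \<noteq> 0"
    proof (rule ccontr)
      assume "\<not> ?thesis"
      then have Qv: "Q n v = v" for n by (simp add: cproj_def cblinfun_op_apply)
      have "norm v \<le> norm (Q n o\<^sub>C ?L) * norm v" for n
      proof -
        have "(Q n o\<^sub>C ?L) v = - v"
          using v(1) Qv by (simp add: cblinfun_op_apply cblinfun_apply_linear)
        then show ?thesis using norm_cblinfun[of "Q n o\<^sub>C ?L" v] by simp
      qed
      then have "1 \<le> norm (Q n o\<^sub>C ?L)" for n using v(2) by simp
      moreover have "(\<lambda>n. norm (Q n o\<^sub>C ?L)) \<longlonglongrightarrow> 0"
        using reg by (simp add: regularizes_def Pcompact_iff)
      ultimately have "1 \<le> (0::real)" by (intro LIMSEQ_le_const) auto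
      then show False by simp
    qed
    then obtain n where "P n v \<noteq> 0" by blast
    then obtain f :: "'a cdual" where f: "f (P n v) \<noteq> 0" by (rule cdual_separates)
    have "(\<lambda>m. norm f * norm (P n o\<^sub>C Q m)) \<longlonglongrightarrow> 0"
      using P_Pcompact[of n] by (intro tendsto_mult_right_zero) (simp add: Pcompact_iff)
    then have "(\<lambda>m. norm ((f o\<^sub>C P n) o\<^sub>C Q m)) \<longlonglongrightarrow> 0"
      by (rule tendsto_sandwich[OF _ _ tendsto_const, rotated 2])
        (simp_all add: cblinfun_compose_assoc norm_cblinfun_compose)
    then show "\<exists>g\<in>?G. g v \<noteq> 0"
      using f by (intro bexI[of _ "f o\<^sub>C P n"]) (simp_all add: cblinfun_op_apply)
  qed
  then obtain U g where U: "finite U" "U \<subseteq> ?V" "\<forall>u\<in>U. g u \<in> ?G"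
    "\<forall>u\<in>U. \<forall>v\<in>U. cblinfun_apply (g u) v = (if u = v then 1 else 0)" "S \<subseteq> complex_vector.span U"
    by (elim exE conjE)
  have "?V \<subseteq> complex_vector.span U"
    using S(3) complex_vector.span_minimal[OF U(5) complex_vector.subspace_span] by blast
  with U show thesis by (intro that[of U g]) auto
qed

end

section \<open>The lower bound for the essential lower norm\<close>

text \<open>
  The perturbation is \<open>L \<oplus> L\<^sup>* + F\<close>, where \<open>L = B - A\<close> leads to the Fredholm operator \<open>B\<close> and \<open>F\<close> is the
  off-diagonal finite-rank operator for \<open>B\<close>. The regularizer \<open>R \<oplus> R\<^sup>*\<close> has norm at most \<open>\<parallel>R\<parallel>\<close>.
\<close>

theorem nu_ess_dsum_ge_inverse_norm:
  fixes P :: "nat \<Rightarrow> 'a::complex_banach endo"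
  assumes nested: "nested_projections P" and A: "A \<in> Palg P" and R: "regularizes P A R"
    and B: "B \<in> Pcoset P A" "fredholm B"
  shows "inverse (norm R) \<le> nu_ess (dsum_seq P (adjoint_seq P)) (A \<oplus>\<^sub>C cblinfun_adjoint A)"
proof -
  interpret nested_projections P by fact
  let ?Z = "dsum_seq P (adjoint_seq P)"
  interpret Z: nested_projections ?Z
    by (intro nested_projections_dsum nested_projections_adjoint nested)
  define L where "L = B - A"
  have L: "L \<in> Pcompact P" using B(1) by (simp add: L_def Pcoset_iff)
  have reg: "regularizes P B R"
    using regularizes_perturb[OF R A Pcompact_zero L] by (simp add: L_def)
  obtain S and h :: "'a \<Rightarrow> 'a cdual"
    where S: "finite S" "complex_vector.span (range B \<union> S) = UNIV"
      and Q_S: "\<And>s. s \<in> S \<Longrightarrow> (\<lambda>n. norm (Q n s)) \<longlonglongrightarrow> 0"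
      and h: "\<And>s x. s \<in> S \<Longrightarrow> h s (B x) = 0" "\<And>s t. s \<in> S \<Longrightarrow> t \<in> S \<Longrightarrow> h s t = (if s = t then 1 else 0)"
    by (rule fredholm_cokernel_system[OF B(2) reg]) blast
  obtain U and g :: "'a \<Rightarrow> 'a cdual"
    where U: "finite U" "{x. B x = 0} \<subseteq> complex_vector.span U" "\<And>u. u \<in> U \<Longrightarrow> B u = 0"
      and Q_U: "\<And>u. u \<in> U \<Longrightarrow> (\<lambda>n. norm (g u o\<^sub>C Q n)) \<longlonglongrightarrow> 0"
      and g: "\<And>u v. u \<in> U \<Longrightarrow> v \<in> U \<Longrightarrow> g u v = (if u = v then 1 else 0)"
    by (rule fredholm_kernel_system[OF B(2) reg]) blast
  define F where "F = cblinfun_offdiag (\<Sum>s\<in>S. rank_one s (evaluation s)) (\<Sum>u\<in>U. rank_one (g u) (g u))"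
  have F: "F \<in> Pcompact ?Z"
    unfolding F_def by (rule Pcompact_offdiag_finite_rank[OF S(1) Q_S U(1) Q_U])
  obtain c where c: "\<And>p. norm p \<le> c * norm (((B \<oplus>\<^sub>C cblinfun_adjoint B) + F) p)"
    using offdiag_perturbation_bounded_below[OF S h U g] unfolding F_def by blast
  define K where "K = (L \<oplus>\<^sub>C cblinfun_adjoint L) + F"
  have DK: "(A \<oplus>\<^sub>C cblinfun_adjoint A) + K = (B \<oplus>\<^sub>C cblinfun_adjoint B) + F"
    by (simp add: K_def L_def adjoint_diff dsum_diff)
  let ?C = "R \<oplus>\<^sub>C cblinfun_adjoint R"
  have RP: "R \<in> Palg P" using R by (simp add: regularizes_def)
  have "?C o\<^sub>C ((A \<oplus>\<^sub>C cblinfun_adjoint A) + K) - cblinfun_id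
      = ((R o\<^sub>C B - cblinfun_id) \<oplus>\<^sub>C cblinfun_adjoint (B o\<^sub>C R - cblinfun_id)) + ?C o\<^sub>C F"
    unfolding DK cblinfun_compose_add_right dsum_compose adjoint_diff adjoint_compose adjoint_id
      dsum_diff dsum_id by simp
  also have "\<dots> \<in> Pcompact ?Z"
    using reg dsum_adjoint_Palg(1)[OF nested RP] F
    by (intro Pcompact_add Pcompact_dsum_adjoint) (simp_all add: regularizes_def Palg_def)
  finally have C: "?C o\<^sub>C ((A \<oplus>\<^sub>C cblinfun_adjoint A) + K) - cblinfun_id \<in> Pcompact ?Z" .
  show ?thesis
  proof (rule Z.nu_ess_ge[where K = K and c = c and C = ?C])
    show "K \<in> Pcompact ?Z"
      unfolding K_def by (intro Pcompact_add Pcompact_dsum_adjoint L F)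
    show "norm p \<le> c * norm (((A \<oplus>\<^sub>C cblinfun_adjoint A) + K) p)" for p
      unfolding DK by (rule c)
    show "(A \<oplus>\<^sub>C cblinfun_adjoint A) o\<^sub>C ?Z n \<in> Pcompact ?Z" for n
      by (rule dsum_adjoint_Palg(2)[OF nested A])
    show "(\<lambda>n. norm (Z.Q n o\<^sub>C (?C o\<^sub>C ((A \<oplus>\<^sub>C cblinfun_adjoint A) + K) - cblinfun_id))) \<longlonglongrightarrow> 0"
      using C by (simp add: Pcompact_iff)
    show "norm ?C \<le> norm R"
      using norm_dsum_le[of R "cblinfun_adjoint R"] norm_adjoint_le[of R] by simp
    show "0 < norm R"
      using regularizer_norm_ge[OF R] by (auto intro: ccontr)
  qed
qed

theorem theorem5p16:
  fixes P :: "nat \<Rightarrow> 'a::complex_banach endo"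
    and A :: "'a endo"
  assumes "uniform_approx_proj P"
    and "A \<in> Palg P"
    and "P_Fredholm P A"
    and "\<exists>B \<in> Pcoset P A. fredholm B"
  shows "nu_ess (dsum_seq P (adjoint_seq P)) (A \<oplus>\<^sub>C cblinfun_adjoint A)
      = mu_tilde (dsum_seq P (adjoint_seq P)) (A \<oplus>\<^sub>C cblinfun_adjoint A) \<and>
    mu_tilde (dsum_seq P (adjoint_seq P)) (A \<oplus>\<^sub>C cblinfun_adjoint A) = mu P A \<and>
    mu P A = inverse (coset_norm (inv\<^bsub>Pquot P\<^esub> (Pcoset P A)))"
proof -
  have nested: "nested_projections P" by (rule uniform_approx_proj_nested) fact
  note nested_adj = nested_projections_adjoint[OF nested]
  interpret nested_projections P by fact
  interpret Z: nested_projections "dsum_seq P (adjoint_seq P)"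
    by (rule nested_projections_dsum[OF nested nested_adj])
  let ?D = "A \<oplus>\<^sub>C cblinfun_adjoint A"
  let ?X = "inv\<^bsub>Pquot P\<^esub> (Pcoset P A)"
  let ?nu = "nu_ess (dsum_seq P (adjoint_seq P)) ?D"
  let ?mu = "mu_tilde (dsum_seq P (adjoint_seq P)) ?D"
  note X = inverse_coset_regularizers[OF assms(3)]
  have q: "coset_norm ?X > 0" and mu_le: "mu_tilde P A \<le> inverse (coset_norm ?X)"
    by (rule mu_tilde_le_inverse_coset_norm[OF assms(3)])+
  obtain B where B: "B \<in> Pcoset P A" "fredholm B" using assms(4) by blast
  have ge: "inverse (norm R) \<le> ?nu" "norm R > 0" if "R \<in> ?X" for R
  proof -
    show "inverse (norm R) \<le> ?nu"
      by (rule nu_ess_dsum_ge_inverse_norm[OF nested assms(2) X(2)[OF that] B])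
    show "norm R > 0" using q coset_norm_le[OF that] by linarith
  qed
  obtain R where "R \<in> ?X" using X(1) by blast
  then have "?nu > 0" using ge[of R] by (meson inverse_positive_iff_positive less_le_trans)
  then have "inverse ?nu \<le> norm R" if "R \<in> ?X" for R
    using ge[OF that] by (metis inverse_inverse_eq inverse_positive_iff_positive le_imp_inverse_le)
  then have "inverse ?nu \<le> coset_norm ?X"
    by (intro coset_norm_greatest X(1))
  then have "inverse (coset_norm ?X) \<le> ?nu"
    using \<open>?nu > 0\<close> by (metis inverse_inverse_eq inverse_positive_iff_positive le_imp_inverse_le)
  moreover have "?nu \<le> ?mu" by (rule Z.nu_ess_le_mu_tilde)
  moreover have "?mu = mu P A"
    unfolding mu_def by (rule mu_tilde_dsum[OF nested nested_adj])
  moreover have "mu P A \<le> mu_tilde P A" by (simp add: mu_def)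
  ultimately show ?thesis using mu_le by linarith
qed

end
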